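(* Let $a,\sigma>0$ and $\theta\ge 0$ be constants, and let $\nu$ be a Lévy measure concentrated on $(0,\infty)$ with $\int_{(0,\infty)}(\xi\wedge 1)\,\nu(d\xi)<\infty$. For $x\ge 0$ let $(X^x_t)_{t\ge 0}$ be the jump-diffusion CIR (JCIR) process started from $x$, i.e. the unique strong solution of $$dX^x_t=a(\theta-X^x_t)\,dt+\sigma\sqrt{X^x_t}\,dW_t+dJ_t,\qquad X^x_0=x,$$ where $W$ is a one-dimensional Brownian motion and $J$ is an independent pure-jump Lévy process with Lévy measure $\nu$. Let $p(t,x,y)$, $t>0$, $x,y\ge0$, denote the transition densities of the JCIR process, i.e. $p(t,x,\cdot)$ is the density of the law of $X^x_t$ with respect to Lebesgue measure on $\mathbb{R}_+=[0,\infty)$. Suppose that $$\int_{(0,1)}\xi\ln\Big(\frac1\xi\Big)\,\nu(d\xi)<\infty .$$ Then for all $t>0$ and $x,y\ge0$ we have $$p(t,x,y)\ge C(t)\,f(t,x,y),$$ where $C(t)>0$ for all $t>0$ and $f(t,x,y)$ are the transition densities of the CIR process (without jumps), i.e. of the solution of $dY^x_t=a(\theta-Y^x_t)\,dt+\sigma\sqrt{Y^x_t}\,dW_t$, $Y^x_0=x$.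
   Context: All processes live on a filtered probability space $(\Omega,\mathcal F,(\mathcal F_t)_{t\ge0},P)$. The pure-jump Lévy process $J$ has only positive jumps, no drift and no Gaussian part, i.e. $E[e^{uJ_t}]=\exp\big(t\int_{(0,\infty)}(e^{u\xi}-1)\nu(d\xi)\big)$ for $\Re u\le 0$. The stochastic differential equation has a unique strong solution, which stays in $\mathbb{R}_+=[0,\infty)$. Its law is characterized by $$E[e^{uX^x_t}]=\Big(1-\tfrac{\sigma^2}{2a}u(1-e^{-at})\Big)^{-2a\theta/\sigma^2}\exp\big(x\psi(t,u)\big)\exp\Big(\int_0^t\int_{(0,\infty)}\big(e^{\xi\psi(s,u)}-1\big)\nu(d\xi)\,ds\Big),\quad \Re u\le0,$$ with $\psi(t,u)=\dfrac{ue^{-at}}{1-\frac{\sigma^2}{2a}u(1-e^{-at})}$ (principal branch of the power); the CIR process $Y^x$ is the case $\nu=0$. The CIR transition densities are given, for $t>0$ and $y\ge0$, with $\kappa=\frac{2a}{\sigma^2(1-e^{-at})}$, $w=\kappa xe^{-at}$, $v=\kappa y$, $q=\frac{2a\theta}{\sigma^2}-1$, by $$f(t,x,y)=\kappa e^{-w-v}\Big(\frac{v}{w}\Big)^{q/2}I_q\big(2(wv)^{1/2}\big)\ \ (x>0),\qquad f(t,0,y)=\frac{\kappa}{\Gamma(q+1)}v^qe^{-v},$$ where $I_q$ is the modified Bessel function of the first kind of order $q$. *)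

theory Defs
  imports "HOL-Probability.Probability"
begin

section \<open>Processes on a filtered probability space\<close>

text \<open>
  Processes are functions \<open>X :: real \<Rightarrow> 'a \<Rightarrow> real\<close>; only times \<open>t \<ge> 0\<close> are ever used. The library
  locale \<open>filtration\<close> has no room for the ambient measure, hence the additional inclusion.
\<close>

definition filtered_prob_space :: "'a measure \<Rightarrow> (real \<Rightarrow> 'a measure) \<Rightarrow> bool" where
  "filtered_prob_space M F \<longleftrightarrow>
     prob_space M \<and> filtration (space M) F \<and> (\<forall>t. sets (F t) \<subseteq> sets M)"

definition adapted :: "(real \<Rightarrow> 'a measure) \<Rightarrow> (real \<Rightarrow> 'a \<Rightarrow> real) \<Rightarrow> bool" where
  "adapted F X \<longleftrightarrow> (\<forall>t\<ge>0. X t \<in> borel_measurable (F t))"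

definition cadlag :: "(real \<Rightarrow> real) \<Rightarrow> bool" where
  "cadlag x \<longleftrightarrow> (\<forall>t\<ge>0. continuous (at_right t) x) \<and> (\<forall>t>0. \<exists>l. (x \<longlongrightarrow> l) (at_left t))"

text \<open>
  A Levy process relative to \<open>F\<close>: the increment after \<open>s\<close> is independent of all of \<open>F s\<close>, not only
  of the past of \<open>L\<close>. Initial value \<open>0\<close> holds almost surely, path regularity for every \<open>\<omega>\<close>.
\<close>

definition levy_process :: "'a measure \<Rightarrow> (real \<Rightarrow> 'a measure) \<Rightarrow> (real \<Rightarrow> 'a \<Rightarrow> real) \<Rightarrow> bool" where
  "levy_process M F L \<longleftrightarrow>
     adapted F L \<and>
     (AE \<omega> in M. L 0 \<omega> = 0) \<and>
     (\<forall>s t. 0 \<le> s \<and> s \<le> t \<longrightarrow>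
        prob_space.indep_set M (sets (F s))
          (sets (vimage_algebra (space M) (\<lambda>\<omega>. L t \<omega> - L s \<omega>) borel))) \<and>
     (\<forall>s t. 0 \<le> s \<and> s \<le> t \<longrightarrow>
        distr M borel (\<lambda>\<omega>. L t \<omega> - L s \<omega>) = distr M borel (L (t - s))) \<and>
     (\<forall>\<omega>\<in>space M. cadlag (\<lambda>t. L t \<omega>))"

definition brownian_motion :: "'a measure \<Rightarrow> (real \<Rightarrow> 'a measure) \<Rightarrow> (real \<Rightarrow> 'a \<Rightarrow> real) \<Rightarrow> bool" where
  "brownian_motion M F W \<longleftrightarrow>
     levy_process M F W \<and>
     (\<forall>t>0. distributed M lborel (W t) (\<lambda>w. ennreal (normal_density 0 (sqrt t) w))) \<and>
     (\<forall>\<omega>\<in>space M. continuous_on {0..} (\<lambda>t. W t \<omega>))"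

text \<open>A Levy measure concentrated on \<open>(0,\<infinity>)\<close> that integrates \<open>min \<xi> 1\<close>.\<close>

definition positive_levy_measure :: "real measure \<Rightarrow> bool" where
  "positive_levy_measure \<nu> \<longleftrightarrow>
     sets \<nu> = sets borel \<and> emeasure \<nu> {..0} = 0 \<and>
     (\<integral>\<^sup>+ \<xi>\<in>{0<..}. ennreal (min \<xi> 1) \<partial>\<nu>) < \<infinity>"

definition pure_jump_levy_process ::
    "'a measure \<Rightarrow> (real \<Rightarrow> 'a measure) \<Rightarrow> real measure \<Rightarrow> (real \<Rightarrow> 'a \<Rightarrow> real) \<Rightarrow> bool" where
  "pure_jump_levy_process M F \<nu> J \<longleftrightarrow>
     levy_process M F J \<and>
     (\<forall>t\<ge>0. \<forall>u::complex. Re u \<le> 0 \<longrightarrow>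
        (LINT \<omega>|M. exp (u * of_real (J t \<omega>)))
          = exp (of_real t * (LINT \<xi>:{0<..}|\<nu>. exp (u * of_real \<xi>) - 1)))"

definition independent_processes ::
    "'a measure \<Rightarrow> (real \<Rightarrow> 'a \<Rightarrow> real) \<Rightarrow> (real \<Rightarrow> 'a \<Rightarrow> real) \<Rightarrow> bool" where
  "independent_processes M X Y \<longleftrightarrow>
     prob_space.indep_var M
       (PiM {0..} (\<lambda>_. borel)) (\<lambda>\<omega>. \<lambda>t\<in>{0..}. X t \<omega>)
       (PiM {0..} (\<lambda>_. borel)) (\<lambda>\<omega>. \<lambda>t\<in>{0..}. Y t \<omega>)"


section \<open>The Ito integral\<close>

text \<open>Convergence to \<open>0\<close> in probability of nonnegative random variables.\<close>

definition null_in_prob :: "'a measure \<Rightarrow> (nat \<Rightarrow> 'a \<Rightarrow> ennreal) \<Rightarrow> bool" where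
  "null_in_prob M Z \<longleftrightarrow>
     (\<forall>k. Z k \<in> borel_measurable M) \<and>
     (\<forall>\<epsilon>>0. (\<lambda>k. measure M {\<omega>\<in>space M. \<epsilon> < Z k \<omega>}) \<longlonglongrightarrow> 0)"

text \<open>
  \<open>(n, \<tau>, \<xi>)\<close> encodes the simple process on \<open>[0,t]\<close> that equals \<open>\<xi> i\<close> on \<open>(\<tau> i, \<tau> (i + 1)]\<close> for \<open>i < n\<close>
  and vanishes elsewhere.
\<close>

definition simple_integrand ::
    "(real \<Rightarrow> 'a measure) \<Rightarrow> real \<Rightarrow> nat \<Rightarrow> (nat \<Rightarrow> real) \<Rightarrow> (nat \<Rightarrow> 'a \<Rightarrow> real) \<Rightarrow> bool" where
  "simple_integrand F t n \<tau> \<xi> \<longleftrightarrow>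
     0 \<le> \<tau> 0 \<and> \<tau> n \<le> t \<and>
     (\<forall>i<n. \<tau> i \<le> \<tau> (Suc i) \<and> \<xi> i \<in> borel_measurable (F (\<tau> i)) \<and>
            (\<exists>B. \<forall>\<omega>\<in>space (F (\<tau> i)). \<bar>\<xi> i \<omega>\<bar> \<le> B))"

definition simple_value ::
    "nat \<Rightarrow> (nat \<Rightarrow> real) \<Rightarrow> (nat \<Rightarrow> 'a \<Rightarrow> real) \<Rightarrow> real \<Rightarrow> 'a \<Rightarrow> real" where
  "simple_value n \<tau> \<xi> s \<omega> = (\<Sum>i<n. \<xi> i \<omega> * indicator {\<tau> i<..\<tau> (Suc i)} s)"

definition simple_integral ::
    "(real \<Rightarrow> 'a \<Rightarrow> real) \<Rightarrow> nat \<Rightarrow> (nat \<Rightarrow> real) \<Rightarrow> (nat \<Rightarrow> 'a \<Rightarrow> real) \<Rightarrow> 'a \<Rightarrow> real" where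
  "simple_integral W n \<tau> \<xi> \<omega> = (\<Sum>i<n. \<xi> i \<omega> * (W (\<tau> (Suc i)) \<omega> - W (\<tau> i) \<omega>))"

text \<open>
  \<open>I\<close> is (a version of) \<open>\<integral>\<^sub>0\<^sup>t H\<^sub>s dW\<^sub>s\<close>: there are simple processes \<open>H\<^sup>k\<close> with
  \<open>\<integral>\<^sub>0\<^sup>t (H\<^sup>k\<^sub>s - H\<^sub>s)\<^sup>2 ds \<longrightarrow> 0\<close> and \<open>\<integral>\<^sub>0\<^sup>t H\<^sup>k\<^sub>s dW\<^sub>s \<longrightarrow> I\<close>, both in probability. This determines \<open>I\<close> up
  to null sets.
\<close>

definition has_ito_integral ::
    "'a measure \<Rightarrow> (real \<Rightarrow> 'a measure) \<Rightarrow> (real \<Rightarrow> 'a \<Rightarrow> real) \<Rightarrow> (real \<Rightarrow> 'a \<Rightarrow> real)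
      \<Rightarrow> real \<Rightarrow> ('a \<Rightarrow> real) \<Rightarrow> bool" where
  "has_ito_integral M F W H t I \<longleftrightarrow>
     I \<in> borel_measurable M \<and>
     (\<exists>n \<tau> \<xi>.
        (\<forall>k. simple_integrand F t (n k) (\<tau> k) (\<xi> k)) \<and>
        null_in_prob M
          (\<lambda>k \<omega>. \<integral>\<^sup>+ s\<in>{0..t}. ennreal ((simple_value (n k) (\<tau> k) (\<xi> k) s \<omega> - H s \<omega>)\<^sup>2) \<partial>lborel) \<and>
        null_in_prob M
          (\<lambda>k \<omega>. ennreal \<bar>simple_integral W (n k) (\<tau> k) (\<xi> k) \<omega> - I \<omega>\<bar>))"


section \<open>The JCIR process\<close>

text \<open>
  \<open>dX = a (\<theta> - X) dt + \<sigma> sqrt X dW + dJ\<close>, \<open>X 0 = x\<close>, in integral form. The paths are cadlag, so using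
  \<open>X s\<close> rather than its left limit in the integrands changes them at countably many times only.
\<close>

definition jcir_process ::
    "'a measure \<Rightarrow> (real \<Rightarrow> 'a measure) \<Rightarrow> real \<Rightarrow> real \<Rightarrow> real
      \<Rightarrow> (real \<Rightarrow> 'a \<Rightarrow> real) \<Rightarrow> (real \<Rightarrow> 'a \<Rightarrow> real) \<Rightarrow> real \<Rightarrow> (real \<Rightarrow> 'a \<Rightarrow> real) \<Rightarrow> bool" where
  "jcir_process M F a \<sigma> \<theta> W J x X \<longleftrightarrow>
     adapted F X \<and>
     (\<forall>\<omega>\<in>space M. cadlag (\<lambda>t. X t \<omega>)) \<and>
     (\<forall>\<omega>\<in>space M. \<forall>t\<ge>0. 0 \<le> X t \<omega>) \<and>
     (\<forall>t\<ge>0. \<exists>I. has_ito_integral M F W (\<lambda>s \<omega>. \<sigma> * sqrt (X s \<omega>)) t I \<and>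
        (AE \<omega> in M. X t \<omega> = x + (LINT s:{0..t}|lborel. a * (\<theta> - X s \<omega>)) + I \<omega> + J t \<omega>))"

text \<open>\<open>p t x\<close> is a density of the law of \<open>X x t\<close> with respect to Lebesgue measure on \<open>[0,\<infinity>)\<close>.\<close>

definition transition_density ::
    "'a measure \<Rightarrow> (real \<Rightarrow> real \<Rightarrow> 'a \<Rightarrow> real) \<Rightarrow> (real \<Rightarrow> real \<Rightarrow> real \<Rightarrow> real) \<Rightarrow> bool" where
  "transition_density M X p \<longleftrightarrow>
     (\<forall>t>0. \<forall>x\<ge>0. (\<forall>y\<ge>0. 0 \<le> p t x y) \<and>
        distributed M (restrict_space lborel {0..}) (X x t) (\<lambda>y. ennreal (p t x y)))"

definition jcir_psi :: "real \<Rightarrow> real \<Rightarrow> real \<Rightarrow> complex \<Rightarrow> complex" where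
  "jcir_psi a \<sigma> t u =
     u * of_real (exp (- a * t)) / (1 - of_real (\<sigma>\<^sup>2 / (2 * a)) * u * of_real (1 - exp (- a * t)))"

text \<open>Complex \<open>powr\<close> is the principal branch.\<close>

definition jcir_transform ::
    "real \<Rightarrow> real \<Rightarrow> real \<Rightarrow> real measure \<Rightarrow> real \<Rightarrow> real \<Rightarrow> complex \<Rightarrow> complex" where
  "jcir_transform a \<sigma> \<theta> \<nu> t x u =
     (1 - of_real (\<sigma>\<^sup>2 / (2 * a)) * u * of_real (1 - exp (- a * t)))
         powr of_real (- 2 * a * \<theta> / \<sigma>\<^sup>2)
     * exp (of_real x * jcir_psi a \<sigma> t u)
     * exp (LINT s:{0..t}|lborel. LINT \<xi>:{0<..}|\<nu>. exp (of_real \<xi> * jcir_psi a \<sigma> s u) - 1)"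


section \<open>The CIR transition densities\<close>

text \<open>
  Powers with nonnegative base and the convention \<open>0\<^sup>0 = 1\<close> (in the library \<open>0 powr 0 = 0\<close>); it matters
  only for \<open>q = 0\<close> at \<open>y = 0\<close>. For \<open>q < 0\<close> the textbook formula is singular at \<open>y = 0\<close>; there the
  value below is \<open>0\<close>.
\<close>

definition rpow :: "real \<Rightarrow> real \<Rightarrow> real" where
  "rpow z s = (if s = 0 then 1 else z powr s)"

text \<open>
  The reciprocal Gamma function \<open>rGamma\<close> vanishes at the poles of \<open>Gamma\<close>, which gives the usual
  meaning to the series for \<open>q = - 1\<close> (the case \<open>\<theta> = 0\<close>).
\<close>

definition bessel_I :: "real \<Rightarrow> real \<Rightarrow> real" where
  "bessel_I q z = rpow (z / 2) q * (\<Sum>k. (z / 2) ^ (2 * k) * rGamma (q + of_nat k + 1) / fact k)"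

definition cir_density :: "real \<Rightarrow> real \<Rightarrow> real \<Rightarrow> real \<Rightarrow> real \<Rightarrow> real \<Rightarrow> real" where
  "cir_density a \<sigma> \<theta> t x y =
     (let \<kappa> = 2 * a / (\<sigma>\<^sup>2 * (1 - exp (- a * t)));
          w = \<kappa> * x * exp (- a * t);
          v = \<kappa> * y;
          q = 2 * a * \<theta> / \<sigma>\<^sup>2 - 1
      in if x > 0 then \<kappa> * exp (- w - v) * rpow (v / w) (q / 2) * bessel_I q (2 * sqrt (w * v))
         else \<kappa> * rGamma (q + 1) * rpow v q * exp (- v))"

end

theory Submission
  imports Defs
begin

text \<open>
  By the transform, the law of \<open>X\<^sub>t\<close> is the convolution of the CIR law with a compound Poisson law: jumps
  of size \<open>\<xi>\<close> arrive at rate \<open>\<nu>(d\<xi>)\<close>, and each of them starts an independent diffusion with \<open>\<theta> = 0\<close>, which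
  runs for the remaining time \<open>s\<close> and is by then absorbed at \<open>0\<close> with probability \<open>exp (- \<xi> \<beta> s)\<close>, where
  \<open>- \<beta> s\<close> is the limit of \<open>\<psi>(s, u)\<close> as \<open>u\<close> tends to \<open>-\<infinity>\<close>. Only the surviving ones contribute to \<open>X\<^sub>t\<close>,
  and their expected number is \<open>\<Lambda> = \<integral>\<integral> (1 - exp (- \<xi> \<beta> s)) \<nu>(d\<xi>) ds\<close> over \<open>0 < s \<le> t\<close>. Since
  \<open>\<beta> s \<le> 2 / (\<sigma>\<^sup>2 s)\<close>, integrating in \<open>s\<close> first costs a multiple of \<open>\<xi> (1 + ln (1/\<xi>))\<close> for a small jump, so
  \<open>\<Lambda>\<close> is finite by the logarithmic moment. Hence with probability \<open>exp (- \<Lambda>) > 0\<close>, whatever the starting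
  point, no jump contributes, and \<open>C t = exp (- \<Lambda>)\<close> is a possible constant.

  The proof below makes this precise without building these laws. It evaluates the transform at
  \<open>u = 0, -1, -2, \<dots>\<close> only, i.e. it looks at the moments of \<open>exp (- X\<^sub>t)\<close>, which lives in \<open>[0,1]\<close>. By
  Hausdorff's moment theorem in the form of Bernstein polynomials, a measure on \<open>[0,1]\<close> dominates
  another one as soon as the difference of their moment sequences is completely monotone
  (\<open>Laplace_comparison\<close>). The jump factor of the transform is \<open>exp (\<eta> n - \<Lambda>)\<close> with \<open>\<eta>\<close> completely
  monotone (\<open>jump_exponent_completely_monotone\<close>), because \<open>\<eta>\<close> is a mixture of sequences
  \<open>exp (- \<xi> \<beta>) (exp (\<xi> \<beta> / (1 + n b)) - 1)\<close>. Complete monotonicity is stable under products, hence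
  \<open>L n * (exp (\<eta> n) - 1)\<close> is completely monotone, where \<open>L\<close> is the transform of the CIR law; this is, up to the
  factor \<open>exp (- \<Lambda>)\<close>, the difference between the transform of \<open>X\<^sub>t\<close> and \<open>exp (- \<Lambda>) L\<close>. Finally the CIR
  density has the right transform since the Bessel series exhibits it as a Poisson mixture of gamma
  densities (\<open>nn_integral_cir_density_laplace\<close>).
\<close>

section \<open>Completely monotone sequences\<close>

definition decrement :: "(nat \<Rightarrow> real) \<Rightarrow> nat \<Rightarrow> real" where
  "decrement f n = f n - f (Suc n)"

text \<open>
  For a probability measure on \<open>[0,1]\<close> with moments \<open>f n\<close>, the iterated difference
  \<open>(decrement ^^ m) f n\<close> is the integral of \<open>z ^ n * (1 - z) ^ m\<close>; see \<open>decrement_pow_power\<close>. The definition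
  thus lists the sign conditions that a moment sequence satisfies.
\<close>

definition completely_monotone :: "(nat \<Rightarrow> real) \<Rightarrow> bool" where
  "completely_monotone f \<longleftrightarrow> (\<forall>m n. 0 \<le> (decrement ^^ m) f n)"

lemma decrement_pow_Suc: "(decrement ^^ Suc m) f n = (decrement ^^ m) f n - (decrement ^^ m) f (Suc n)"
  by (simp add: decrement_def)

lemma decrement_pow_add:
  "(decrement ^^ m) (\<lambda>n. f n + g n) n = (decrement ^^ m) f n + (decrement ^^ m) g n"
  by (induction m arbitrary: n) (simp_all add: decrement_pow_Suc del: funpow.simps(2))

lemma decrement_pow_cmult:
  "(decrement ^^ m) (\<lambda>n. c * f n) n = c * (decrement ^^ m) f n"
  by (induction m arbitrary: n) (simp_all add: decrement_pow_Suc algebra_simps del: funpow.simps(2))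

lemma decrement_pow_shift:
  "(decrement ^^ m) (\<lambda>n. f (Suc n)) n = (decrement ^^ m) f (Suc n)"
  by (induction m arbitrary: n) (simp_all add: decrement_pow_Suc del: funpow.simps(2))

lemma decrement_pow_tendsto:
  assumes "\<And>n. (\<lambda>k. f k n) \<longlonglongrightarrow> g n"
  shows "(\<lambda>k. (decrement ^^ m) (f k) n) \<longlonglongrightarrow> (decrement ^^ m) g n"
  using assms
  by (induction m arbitrary: n)
     (auto simp: decrement_pow_Suc simp del: funpow.simps(2) intro!: tendsto_diff)

text \<open>
  Integrability and the exchange are proved together, since the induction step for the exchange
  needs the integrability of the lower differences.
\<close>

lemma decrement_pow_integral:
  fixes f :: "'b \<Rightarrow> nat \<Rightarrow> real"
  assumes "\<And>n. integrable M (\<lambda>x. f x n)"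
  shows "integrable M (\<lambda>x. (decrement ^^ m) (f x) n) \<and>
         (decrement ^^ m) (\<lambda>n. \<integral>x. f x n \<partial>M) n = (\<integral>x. (decrement ^^ m) (f x) n \<partial>M)"
  using assms
  by (induction m arbitrary: n)
     (simp_all add: decrement_pow_Suc del: funpow.simps(2))

lemma completely_monotone_nonneg: "completely_monotone f \<Longrightarrow> 0 \<le> f n"
  unfolding completely_monotone_def by (metis funpow_0)

lemma completely_monotone_add:
  "completely_monotone f \<Longrightarrow> completely_monotone g \<Longrightarrow> completely_monotone (\<lambda>n. f n + g n)"
  by (simp add: completely_monotone_def decrement_pow_add)

lemma completely_monotone_cmult:
  "0 \<le> c \<Longrightarrow> completely_monotone f \<Longrightarrow> completely_monotone (\<lambda>n. c * f n)"
  by (simp add: completely_monotone_def decrement_pow_cmult)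

lemma completely_monotone_const:
  assumes "0 \<le> c" shows "completely_monotone (\<lambda>n. c)"
proof -
  have "(decrement ^^ m) (\<lambda>n. c) n = (if m = 0 then c else 0)" for m n
    by (induction m arbitrary: n) (simp_all add: decrement_pow_Suc del: funpow.simps(2))
  then show ?thesis using assms by (simp add: completely_monotone_def)
qed

lemma completely_monotone_limit:
  assumes "\<And>k. completely_monotone (f k)" and "\<And>n. (\<lambda>k. f k n) \<longlonglongrightarrow> g n"
  shows "completely_monotone g"
  unfolding completely_monotone_def
proof (intro allI)
  fix m n
  show "0 \<le> (decrement ^^ m) g n"
    using assms(1) by (intro LIMSEQ_le_const[OF decrement_pow_tendsto[OF assms(2)]])
      (auto simp: completely_monotone_def)
qed

lemma completely_monotone_integral:
  fixes f :: "'b \<Rightarrow> nat \<Rightarrow> real"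
  assumes "\<And>n. integrable M (\<lambda>x. f x n)"
    and "\<And>x. x \<in> space M \<Longrightarrow> completely_monotone (f x)"
  shows "completely_monotone (\<lambda>n. \<integral>x. f x n \<partial>M)"
  using assms decrement_pow_integral[of M f]
  by (auto simp: completely_monotone_def intro!: integral_nonneg_AE)

lemma completely_monotone_decrement:
  "completely_monotone f \<Longrightarrow> completely_monotone (\<lambda>n. f n - f (Suc n))"
  unfolding completely_monotone_def
  by (metis (no_types, lifting) decrement_def ext funpow_Suc_right o_apply)

lemma completely_monotone_shift:
  "completely_monotone f \<Longrightarrow> completely_monotone (\<lambda>n. f (Suc n))"
  by (simp add: completely_monotone_def decrement_pow_shift)

text \<open>
  The discrete Leibniz rule writes the difference of a product as a sum of products of completely
  monotone sequences: one factor is a difference, the other one a shift.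
\<close>

lemma completely_monotone_mult:
  assumes "completely_monotone f" "completely_monotone g"
  shows "completely_monotone (\<lambda>n. f n * g n)"
proof -
  have "0 \<le> (decrement ^^ m) (\<lambda>n. f n * g n) n" for m n
    using assms
  proof (induction m arbitrary: f g n)
    case 0
    then show ?case by (simp add: completely_monotone_nonneg)
  next
    case (Suc m)
    have "decrement (\<lambda>n. f n * g n) = (\<lambda>n. (f n - f (Suc n)) * g n + f (Suc n) * (g n - g (Suc n)))"
      by (auto simp: decrement_def algebra_simps)
    then have "(decrement ^^ Suc m) (\<lambda>n. f n * g n) n =
        (decrement ^^ m) (\<lambda>n. (f n - f (Suc n)) * g n) n +
        (decrement ^^ m) (\<lambda>n. f (Suc n) * (g n - g (Suc n))) n"
      by (simp add: funpow_Suc_right decrement_pow_add del: funpow.simps(2))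
    then show ?case
      using Suc completely_monotone_decrement completely_monotone_shift by auto
  qed
  then show ?thesis by (simp add: completely_monotone_def)
qed

lemma completely_monotone_power:
  "completely_monotone f \<Longrightarrow> completely_monotone (\<lambda>n. f n ^ k)"
  by (induction k) (simp_all add: completely_monotone_const completely_monotone_mult)

lemma completely_monotone_sum:
  assumes "\<And>i. i \<in> A \<Longrightarrow> completely_monotone (f i)"
  shows "completely_monotone (\<lambda>n. \<Sum>i\<in>A. f i n)"
  using assms
  by (induction A rule: infinite_finite_induct)
     (simp_all add: completely_monotone_const completely_monotone_add)

text \<open>
  The exponential series without its constant term is a limit of polynomials with nonnegative
  coefficients.
\<close>

lemma completely_monotone_exp_minus_1:
  assumes "completely_monotone f"
  shows "completely_monotone (\<lambda>n. exp (f n) - 1)"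
proof (rule completely_monotone_limit)
  show "completely_monotone (\<lambda>n. \<Sum>i<k. inverse (fact (Suc i)) * f n ^ Suc i)" for k
    by (intro completely_monotone_sum completely_monotone_cmult completely_monotone_power assms) simp
  show "(\<lambda>k. \<Sum>i<k. inverse (fact (Suc i)) * f n ^ Suc i) \<longlonglongrightarrow> exp (f n) - 1" for n
  proof -
    have "(\<lambda>i. f n ^ i /\<^sub>R fact i) sums exp (f n)"
      by (rule exp_converges)
    then have "(\<lambda>i. f n ^ Suc i /\<^sub>R fact (Suc i)) sums (exp (f n) - 1)"
      by (subst sums_Suc_iff) simp
    then show ?thesis
      by (simp add: sums_def)
  qed
qed

text \<open>
  The differences telescope to \<open>m! b\<^sup>m\<close> divided by the product of the \<open>m + 1\<close> consecutive denominators.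
\<close>

lemma completely_monotone_inverse_linear:
  fixes b :: real
  assumes "0 \<le> b"
  shows "completely_monotone (\<lambda>n. 1 / (1 + real n * b))"
proof -
  have pos: "0 < 1 + real n * b" for n
    using assms by (simp add: add_pos_nonneg)
  have "(decrement ^^ m) (\<lambda>n. 1 / (1 + real n * b)) n
      = fact m * b ^ m / (\<Prod>i\<le>m. 1 + real (n + i) * b)" for m n
  proof (induction m arbitrary: n)
    case 0
    then show ?case by simp
  next
    case (Suc m)
    let ?Q = "\<Prod>i<m. 1 + real (n + Suc i) * b"
    let ?x = "1 + real n * b" and ?y = "1 + real (n + Suc m) * b"
    have P1: "(\<Prod>i\<le>m. 1 + real (n + i) * b) = ?x * ?Q"
      by (simp add: prod.atMost_shift del: of_nat_Suc of_nat_add)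
    have P2: "(\<Prod>i\<le>m. 1 + real (Suc n + i) * b) = ?Q * ?y"
      by (simp add: lessThan_Suc_atMost[symmetric] del: of_nat_Suc of_nat_add)
    have P3: "(\<Prod>i\<le>Suc m. 1 + real (n + i) * b) = ?x * ?Q * ?y"
      unfolding prod.atMost_Suc P1 ..
    have nz: "?x \<noteq> 0" "?Q \<noteq> 0" "?y \<noteq> 0"
      using pos by (simp_all add: less_imp_neq[THEN not_sym] del: of_nat_add of_nat_Suc)
    have y: "?y = ?x + real (Suc m) * b"
      by (simp add: algebra_simps)
    have telescope: "c / (x * q) - c / (q * (x + d)) = c * d / (x * q * (x + d))"
      if "x \<noteq> 0" "q \<noteq> 0" "x + d \<noteq> 0" for c d x q :: real
      using that by (simp add: divide_simps) (simp add: algebra_simps)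
    have "fact m * b ^ m / (?x * ?Q) - fact m * b ^ m / (?Q * ?y) =
        fact m * b ^ m * (real (Suc m) * b) / (?x * ?Q * ?y)"
      using nz unfolding y by (rule telescope)
    then show ?case
      unfolding decrement_pow_Suc Suc.IH P1 P2 P3 by (simp add: algebra_simps)
  qed
  moreover have "0 \<le> fact m * b ^ m / (\<Prod>i\<le>m. 1 + real (n + i) * b)" for m n
    using assms pos by (intro divide_nonneg_nonneg mult_nonneg_nonneg prod_nonneg ballI less_imp_le[OF pos])
      simp_all
  ultimately show ?thesis
    by (simp add: completely_monotone_def)
qed

lemma decrement_pow_power: "(decrement ^^ m) (\<lambda>n. z ^ n) n = z ^ n * (1 - z) ^ m"
  by (induction m arbitrary: n) (simp_all add: decrement_pow_Suc algebra_simps del: funpow.simps(2))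

lemma completely_monotone_geometric:
  "0 \<le> z \<Longrightarrow> z \<le> 1 \<Longrightarrow> completely_monotone (\<lambda>n. z ^ n)"
  by (simp add: completely_monotone_def decrement_pow_power)

section \<open>Comparison of measures and densities\<close>

text \<open>
  A Bernstein polynomial of \<open>g\<close> is a combination of the functions \<open>z ^ k * (1 - z) ^ m\<close> with coefficients
  \<open>g (k / n) \<ge> 0\<close>, and on these functions complete monotonicity of the moment difference is precisely the
  claimed inequality. The Bernstein polynomials converge to \<open>g\<close> uniformly on \<open>[0,1]\<close>.
\<close>

lemma Hausdorff_comparison_continuous:
  fixes M N :: "real measure" and g :: "real \<Rightarrow> real"
  assumes "finite_measure M" "finite_measure N"
    and setsM [measurable_cong]: "sets M = sets borel" and setsN [measurable_cong]: "sets N = sets borel"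
    and M01: "AE z in M. z \<in> {0..1}" and N01: "AE z in N. z \<in> {0..1}"
    and mono: "completely_monotone (\<lambda>n. (\<integral>z. z ^ n \<partial>N) - (\<integral>z. z ^ n \<partial>M))"
    and cont: "continuous_on UNIV g" and nonneg: "\<And>z. 0 \<le> g z" and bound: "\<And>z. g z \<le> B"
  shows "(\<integral>z. g z \<partial>M) \<le> (\<integral>z. g z \<partial>N)"
proof -
  interpret M: finite_measure M by fact
  interpret N: finite_measure N by fact
  have [measurable]: "g \<in> borel_measurable borel"
    using cont by (rule borel_measurable_continuous_onI)
  have gM: "integrable M g"
    using nonneg bound by (intro M.integrable_const_bound[where B = B]) auto
  have gN: "integrable N g"
    using nonneg bound by (intro N.integrable_const_bound[where B = B]) auto
  have powM: "integrable M (\<lambda>z. z ^ k)" for k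
    using M01 by (intro M.integrable_const_bound[where B = 1]) (auto simp: power_abs intro!: power_le_one)
  have powN: "integrable N (\<lambda>z. z ^ k)" for k
    using N01 by (intro N.integrable_const_bound[where B = 1]) (auto simp: power_abs intro!: power_le_one)
  have monomial: "integrable M (\<lambda>z. z ^ k * (1 - z) ^ m) \<and> integrable N (\<lambda>z. z ^ k * (1 - z) ^ m) \<and>
      (\<integral>z. z ^ k * (1 - z) ^ m \<partial>M) \<le> (\<integral>z. z ^ k * (1 - z) ^ m \<partial>N)" for k m
  proof -
    note M = decrement_pow_integral[of M "\<lambda>z k. z ^ k" m k, OF powM]
      and N = decrement_pow_integral[of N "\<lambda>z k. z ^ k" m k, OF powN]
    have "0 \<le> (decrement ^^ m) (\<lambda>n. (\<integral>z. z ^ n \<partial>N) + (- 1) * (\<integral>z. z ^ n \<partial>M)) k"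
      using mono by (simp add: completely_monotone_def)
    then show ?thesis
      using M N unfolding decrement_pow_add decrement_pow_cmult by (simp add: decrement_pow_power)
  qed
  define P where "P n z = (\<Sum>k\<le>n. g (k / n) * Bernstein n k z)" for n :: nat and z :: real
  have P_eq: "P n = (\<lambda>z. \<Sum>k\<le>n. g (k / n) * (n choose k) * (z ^ k * (1 - z) ^ (n - k)))" for n
    by (simp add: P_def Bernstein_def mult.assoc fun_eq_iff)
  have PM: "integrable M (P n)" and PN: "integrable N (P n)"
    and P_le: "(\<integral>z. P n z \<partial>M) \<le> (\<integral>z. P n z \<partial>N)" for n
    using monomial nonneg
    by (auto simp: P_eq intro!: sum_mono mult_left_mono)
  have approx: "(\<integral>z. g z \<partial>M) \<le> (\<integral>z. g z \<partial>N) + e * (measure M (space M) + measure N (space N))"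
    if "0 < e" for e
  proof -
    obtain n where n: "\<And>z. z \<in> {0..1} \<Longrightarrow> \<bar>g z - P n z\<bar> < e"
      using Bernstein_Weierstrass[OF continuous_on_subset[OF cont] \<open>0 < e\<close>] unfolding P_def by blast
    have "(\<integral>z. g z \<partial>M) \<le> (\<integral>z. P n z + e \<partial>M)"
      using M01 n by (intro integral_mono_AE gM Bochner_Integration.integrable_add PM M.integrable_const)
        (fastforce simp: abs_less_iff)
    also have "\<dots> = (\<integral>z. P n z \<partial>M) + e * measure M (space M)"
      using PM by (simp add: Bochner_Integration.integral_add)
    also have "(\<integral>z. P n z \<partial>M) \<le> (\<integral>z. P n z \<partial>N)"
      by (rule P_le)
    also have "\<dots> \<le> (\<integral>z. g z + e \<partial>N)"
      using N01 n by (intro integral_mono_AE gN Bochner_Integration.integrable_add PN N.integrable_const)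
        (fastforce simp: abs_less_iff)
    also have "\<dots> = (\<integral>z. g z \<partial>N) + e * measure N (space N)"
      using gN by (simp add: Bochner_Integration.integral_add)
    finally show ?thesis by (simp add: algebra_simps)
  qed
  let ?T = "measure M (space M) + measure N (space N)"
  have T: "0 \<le> ?T" by simp
  show ?thesis
  proof (rule field_le_epsilon)
    fix d :: real assume "0 < d"
    then have "0 < d / (?T + 1)" using T by (intro divide_pos_pos) linarith+
    from approx[OF this] have "(\<integral>z. g z \<partial>M) \<le> (\<integral>z. g z \<partial>N) + d / (?T + 1) * ?T" .
    also have "d / (?T + 1) * ?T = d * (?T / (?T + 1))"
      by simp
    also have "\<dots> \<le> d"
      using \<open>0 < d\<close> by (intro mult_left_le) (simp_all add: divide_le_eq add_nonneg_pos)
    finally show "(\<integral>z. g z \<partial>M) \<le> (\<integral>z. g z \<partial>N) + d" by simp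
  qed
qed

text \<open>
  Continuous functions decrease to the indicator of a compact set, which gives the inequality for
  compact sets; inner regularity extends it to Borel sets.
\<close>

lemma emeasure_le_of_continuous_integral_le:
  fixes M N :: "real measure"
  assumes "finite_measure M" "finite_measure N"
    and setsM [measurable_cong]: "sets M = sets borel" and setsN [measurable_cong]: "sets N = sets borel"
    and le: "\<And>g :: real \<Rightarrow> real. continuous_on UNIV g \<Longrightarrow> (\<And>z. 0 \<le> g z) \<Longrightarrow> (\<And>z. g z \<le> 1) \<Longrightarrow>
        (\<integral>z. g z \<partial>M) \<le> (\<integral>z. g z \<partial>N)"
    and A: "A \<in> sets borel"
  shows "emeasure M A \<le> emeasure N A"
proof -
  interpret M: finite_measure M by fact
  interpret N: finite_measure N by fact
  have compact: "emeasure M K \<le> emeasure N K" if "compact K" for K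
  proof (cases "K = {}")
    case False
    have K: "closed K" using that by (rule compact_imp_closed)
    then have [measurable]: "K \<in> sets borel" by simp
    define g where "g k z = max 0 (1 - real k * infdist z K)" for k z
    have cont: "continuous_on UNIV (g k)" for k
      unfolding g_def by (intro continuous_intros)
    then have [measurable]: "g k \<in> borel_measurable borel" for k
      by (rule borel_measurable_continuous_onI)
    have g01: "0 \<le> g k z" "g k z \<le> 1" for k z
      by (auto simp: g_def infdist_nonneg)
    have lim: "(\<lambda>k. g k z) \<longlonglongrightarrow> indicator K z" for z
    proof (cases "z \<in> K")
      case False
      then have d: "0 < infdist z K"
        using K \<open>K \<noteq> {}\<close> by (metis in_closed_iff_infdist_zero infdist_nonneg order_le_less)
      obtain n where n: "1 < real n * infdist z K"
        using d reals_Archimedean3 by blast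
      have "g k z = 0" if "n \<le> k" for k
      proof -
        have "real n * infdist z K \<le> real k * infdist z K"
          using that d by (intro mult_right_mono) auto
        then show ?thesis using n by (simp add: g_def)
      qed
      then show ?thesis using False
        by (intro tendsto_eventually eventually_sequentiallyI[of n]) auto
    qed (simp add: g_def)
    have "(\<lambda>k. \<integral>z. g k z \<partial>M) \<longlonglongrightarrow> (\<integral>z. indicator K z \<partial>M)"
      using g01 lim by (intro integral_dominated_convergence[where w = "\<lambda>_. 1"]) auto
    moreover have "(\<lambda>k. \<integral>z. g k z \<partial>N) \<longlonglongrightarrow> (\<integral>z. indicator K z \<partial>N)"
      using g01 lim by (intro integral_dominated_convergence[where w = "\<lambda>_. 1"]) auto
    ultimately have "(\<integral>z. indicator K z \<partial>M) \<le> (\<integral>z. indicator K z \<partial>N :: real)"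
      by (rule LIMSEQ_le) (auto intro!: le cont g01)
    then show ?thesis
      by (simp add: M.emeasure_eq_measure N.emeasure_eq_measure)
  qed simp
  have "emeasure M A = (SUP K \<in> {K. K \<subseteq> A \<and> compact K}. emeasure M K)"
    using A setsM by (intro inner_regular) (auto simp: M.emeasure_eq_measure)
  also have "\<dots> \<le> emeasure N A"
    using A setsN compact by (intro SUP_least) (auto intro: order_trans[OF compact emeasure_mono])
  finally show ?thesis .
qed

text \<open>
  The substitution \<open>z = exp (- y)\<close> turns the Laplace transforms at the natural numbers into moments on
  \<open>[0,1]\<close>.
\<close>

lemma Laplace_comparison:
  fixes M N :: "real measure"
  assumes fin: "finite_measure M" "finite_measure N"
    and setsM [measurable_cong]: "sets M = sets borel" and setsN [measurable_cong]: "sets N = sets borel"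
    and M0: "AE y in M. 0 \<le> y" and N0: "AE y in N. 0 \<le> y"
    and mono: "completely_monotone (\<lambda>n. (\<integral>y. exp (- (real n * y)) \<partial>N) - (\<integral>y. exp (- (real n * y)) \<partial>M))"
    and A [measurable]: "A \<in> sets borel"
  shows "emeasure M A \<le> emeasure N A"
proof -
  let ?D = "\<lambda>M. distr M borel (\<lambda>y :: real. exp (- y))"
  let ?B = "{z :: real. 0 < z \<and> - ln z \<in> A}"
  have B: "?B \<in> sets borel"
    by measurable
  have power: "exp (- y) ^ n = exp (- (real n * y))" for y :: real and n
    by (simp add: exp_of_nat_mult[symmetric])
  have D: "emeasure (?D M) ?B \<le> emeasure (?D N) ?B"
  proof (rule emeasure_le_of_continuous_integral_le[OF _ _ _ _ _ B])
    show "finite_measure (?D M)" "finite_measure (?D N)"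
      using fin by (auto intro!: finite_measure.finite_measure_distr)
    then show "(\<integral>z. g z \<partial>?D M) \<le> (\<integral>z. g z \<partial>?D N)"
      if "continuous_on UNIV g" "\<And>z. 0 \<le> g z" "\<And>z. g z \<le> 1" for g :: "real \<Rightarrow> real"
      using that M0 N0 mono
      by (intro Hausdorff_comparison_continuous[where B = 1])
         (auto simp: AE_distr_iff integral_distr power)
  qed simp_all
  have vim: "(\<lambda>y :: real. exp (- y)) -` ?B \<inter> space K = A" if "sets K = sets borel" for K :: "real measure"
    using sets_eq_imp_space_eq[OF that] by auto
  show ?thesis
    using D B by (simp add: emeasure_distr vim setsM setsN)
qed

text \<open>
  Tested on the set where the inequality fails, the hypothesis forces the integral of the
  nonnegative difference to vanish there; finiteness makes the subtraction legitimate.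
\<close>

lemma AE_le_of_nn_integral_le:
  fixes f g :: "'b \<Rightarrow> ennreal"
  assumes [measurable]: "f \<in> borel_measurable N" "g \<in> borel_measurable N"
    and fin: "(\<integral>\<^sup>+ x. f x \<partial>N) < \<infinity>"
    and le: "\<And>A. A \<in> sets N \<Longrightarrow> (\<integral>\<^sup>+ x. f x * indicator A x \<partial>N) \<le> (\<integral>\<^sup>+ x. g x * indicator A x \<partial>N)"
  shows "AE x in N. f x \<le> g x"
proof -
  let ?A = "{x \<in> space N. g x < f x}"
  have A [measurable]: "?A \<in> sets N" by measurable
  have fA: "(\<integral>\<^sup>+ x. f x * indicator ?A x \<partial>N) < \<infinity>"
    using fin by (rule le_less_trans[rotated]) (auto intro!: nn_integral_mono split: split_indicator)
  have gf: "(\<integral>\<^sup>+ x. g x * indicator ?A x \<partial>N) \<le> (\<integral>\<^sup>+ x. f x * indicator ?A x \<partial>N)"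
    by (intro nn_integral_mono) (auto split: split_indicator)
  have "(\<integral>\<^sup>+ x. f x * indicator ?A x - g x * indicator ?A x \<partial>N) =
      (\<integral>\<^sup>+ x. f x * indicator ?A x \<partial>N) - (\<integral>\<^sup>+ x. g x * indicator ?A x \<partial>N)"
    using fA gf by (intro nn_integral_diff) (auto split: split_indicator)
  also have "\<dots> = 0"
    using le[OF A] fA by (intro diff_eq_0_ennreal) auto
  finally have "AE x in N. f x * indicator ?A x - g x * indicator ?A x = 0"
    by (subst (asm) nn_integral_0_iff_AE) auto
  moreover have "AE x in N. f x * indicator ?A x \<noteq> \<infinity>"
    using fA by (intro nn_integral_PInf_AE) auto
  ultimately show ?thesis
    using AE_space
  proof eventually_elim
    case (elim x)
    show ?case
    proof (rule ccontr)
      assume "\<not> f x \<le> g x"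
      then have "f x - g x = 0" "g x < f x" using elim by (auto simp: not_le)
      then show False using elim
        by (metis ennreal_minus_eq_0 leD)
    qed
  qed
qed

text \<open>
  A lower bound that holds almost everywhere can be made to hold everywhere by enlarging the density
  on a null set.
\<close>

lemma distributed_max:
  fixes p h :: "real \<Rightarrow> real"
  assumes X: "distributed M R X (\<lambda>y. ennreal (p y))"
    and [measurable]: "h \<in> borel_measurable R"
    and le: "AE y in R. ennreal (h y) \<le> ennreal (p y)"
  shows "distributed M R X (\<lambda>y. ennreal (max (p y) (h y)))"
proof -
  have [measurable]: "(\<lambda>y. ennreal (p y)) \<in> borel_measurable R"
    using X by (rule distributed_borel_measurable)
  have eq: "ennreal (max (p y) (h y)) = max (ennreal (p y)) (ennreal (h y))" for y
    by (cases "p y \<le> h y") (simp_all add: max_absorb1 max_absorb2 ennreal_leI)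
  have "density R (\<lambda>y. ennreal (p y)) = density R (\<lambda>y. ennreal (max (p y) (h y)))"
    using le unfolding eq by (intro density_cong) (auto simp: max_def)
  then show ?thesis
    using X unfolding distributed_def eq by auto
qed

section \<open>The Laplace exponent of the square-root diffusion\<close>

text \<open>
  The reciprocal of the scale \<open>\<kappa>\<close> of the CIR density. In terms of it the denominator of \<open>\<psi>(t, - n)\<close> is
  \<open>1 + n * cir_scale a \<sigma> t\<close>.
\<close>

definition cir_scale :: "real \<Rightarrow> real \<Rightarrow> real \<Rightarrow> real" where
  "cir_scale a \<sigma> t = \<sigma>\<^sup>2 / (2 * a) * (1 - exp (- a * t))"

lemma cir_scale_pos: "0 < a \<Longrightarrow> 0 < \<sigma> \<Longrightarrow> 0 < t \<Longrightarrow> 0 < cir_scale a \<sigma> t"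
  by (simp add: cir_scale_def)

text \<open>
  The limit of \<open>laplace_exponent a \<sigma> n s\<close> as \<open>n\<close> tends to infinity, so that \<open>exp (- (\<xi> * jump_rate a \<sigma> s))\<close>
  is the mass at \<open>0\<close> of the diffusion without drift term \<open>a \<theta>\<close> that starts from \<open>\<xi>\<close> and runs for time \<open>s\<close>.
\<close>

definition jump_rate :: "real \<Rightarrow> real \<Rightarrow> real \<Rightarrow> real" where
  "jump_rate a \<sigma> s = exp (- a * s) / cir_scale a \<sigma> s"

definition laplace_exponent :: "real \<Rightarrow> real \<Rightarrow> nat \<Rightarrow> real \<Rightarrow> real" where
  "laplace_exponent a \<sigma> n s = real n * exp (- a * s) / (1 + real n * cir_scale a \<sigma> s)"

lemma transform_denominator:
  "1 - of_real (\<sigma>\<^sup>2 / (2 * a)) * - of_nat n * of_real (1 - exp (- a * s))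
     = complex_of_real (1 + real n * cir_scale a \<sigma> s)"
  by (simp add: cir_scale_def mult_ac)

lemma jcir_psi_neg_nat:
  "jcir_psi a \<sigma> s (- of_nat n) = - of_real (laplace_exponent a \<sigma> n s)"
  unfolding jcir_psi_def transform_denominator laplace_exponent_def by simp

text \<open>
  This form isolates the dependence on \<open>n\<close> in a single completely monotone factor.
\<close>

lemma laplace_exponent_eq:
  assumes "0 < cir_scale a \<sigma> s"
  shows "laplace_exponent a \<sigma> n s = jump_rate a \<sigma> s - jump_rate a \<sigma> s * (1 / (1 + real n * cir_scale a \<sigma> s))"
proof -
  have "1 + real n * cir_scale a \<sigma> s \<noteq> 0"
    using assms by (metis add_pos_nonneg less_imp_le mult_nonneg_nonneg of_nat_0_le_iff order_less_irrefl zero_less_one)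
  then show ?thesis
    using assms by (simp add: laplace_exponent_def jump_rate_def divide_simps) (simp add: algebra_simps)
qed

section \<open>The Laplace transform of the CIR densities\<close>

text \<open>
  The substitution \<open>t = c y\<close> in Euler's integral.
\<close>

lemma nn_integral_gamma_kernel:
  fixes s c :: real
  assumes "0 < s" "0 < c"
  shows "(\<integral>\<^sup>+ y. ennreal (y powr (s - 1) * exp (- (c * y))) * indicator {0<..} y \<partial>lborel)
      = ennreal (Gamma s / c powr s)"
proof -
  let ?k = "\<lambda>y. y powr (s - 1) * exp (- (c * y))"
  have "ennreal (Gamma s) = (\<integral>\<^sup>+ t. ennreal (indicator {0..} t * t powr (s - 1) / exp t) \<partial>lborel)"
    by (rule Gamma_conv_nn_integral_real[OF \<open>0 < s\<close>])
  also have "\<dots> = ennreal \<bar>c\<bar> *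
      (\<integral>\<^sup>+ y. ennreal (indicator {0..} (0 + c * y) * (0 + c * y) powr (s - 1) / exp (0 + c * y)) \<partial>lborel)"
    using \<open>0 < c\<close> by (intro nn_integral_real_affine) auto
  also have "(\<integral>\<^sup>+ y. ennreal (indicator {0..} (0 + c * y) * (0 + c * y) powr (s - 1) / exp (0 + c * y)) \<partial>lborel)
      = (\<integral>\<^sup>+ y. ennreal (c powr (s - 1)) * (ennreal (?k y) * indicator {0<..} y) \<partial>lborel)"
  proof (intro nn_integral_cong_AE AE_I2)
    fix y :: real
    show "ennreal (indicator {0..} (0 + c * y) * (0 + c * y) powr (s - 1) / exp (0 + c * y))
        = ennreal (c powr (s - 1)) * (ennreal (?k y) * indicator {0<..} y)"
      using \<open>0 < c\<close>
      by (cases "0 < y"; cases "y = 0")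
         (auto simp: indicator_def powr_mult exp_minus ennreal_mult'[symmetric] zero_le_mult_iff
            field_simps split: if_splits)
  qed
  also have "\<dots> = ennreal (c powr (s - 1)) * (\<integral>\<^sup>+ y. ennreal (?k y) * indicator {0<..} y \<partial>lborel)"
    by (intro nn_integral_cmult) measurable
  also have "ennreal \<bar>c\<bar> * (ennreal (c powr (s - 1)) * (\<integral>\<^sup>+ y. ennreal (?k y) * indicator {0<..} y \<partial>lborel))
      = ennreal (c powr s) * (\<integral>\<^sup>+ y. ennreal (?k y) * indicator {0<..} y \<partial>lborel)"
  proof -
    have "c powr s = c * c powr (s - 1)"
      using \<open>0 < c\<close> powr_add[of c 1 "s - 1"] by simp
    then show ?thesis
      using \<open>0 < c\<close> by (simp add: ennreal_mult mult.assoc)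
  qed
  finally have eq: "ennreal (Gamma s) =
      ennreal (c powr s) * (\<integral>\<^sup>+ y. ennreal (?k y) * indicator {0<..} y \<partial>lborel)" .
  have "ennreal (Gamma s / c powr s) = ennreal (1 / c powr s) * ennreal (Gamma s)"
    using Gamma_real_pos[OF \<open>0 < s\<close>] by (simp add: ennreal_mult'[symmetric])
  also have "\<dots> = ennreal (1 / c powr s * c powr s) *
      (\<integral>\<^sup>+ y. ennreal (?k y) * indicator {0<..} y \<partial>lborel)"
    unfolding eq by (subst ennreal_mult) (auto simp: mult.assoc)
  also have "1 / c powr s * c powr s = 1"
    using \<open>0 < c\<close> by simp
  finally show ?thesis by simp
qed

lemma rGamma_nonneg: "0 \<le> (s :: real) \<Longrightarrow> 0 \<le> rGamma s"
  using Gamma_real_pos[of s] by (cases "s = 0") (auto simp: rGamma_inverse_Gamma)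

text \<open>
  A Poisson weight with mean \<open>w\<close> times a gamma density of shape \<open>q + k + 1\<close> and rate \<open>\<kappa>\<close>. For \<open>q = - 1\<close> and
  \<open>k = 0\<close> the shape is \<open>0\<close>, the gamma law degenerates to the point mass at \<open>0\<close>, and \<open>rGamma 0 = 0\<close> drops
  it. The mixture then has total mass \<open>1 - exp (- w)\<close>.
\<close>

definition gamma_mixture_term :: "real \<Rightarrow> real \<Rightarrow> real \<Rightarrow> nat \<Rightarrow> real \<Rightarrow> real" where
  "gamma_mixture_term \<kappa> q w k y = exp (- w) * w ^ k / fact k *
     (\<kappa> powr (q + k + 1) * rGamma (q + k + 1) * y powr (q + k) * exp (- (\<kappa> * y)))"

definition gamma_mixture :: "real \<Rightarrow> real \<Rightarrow> real \<Rightarrow> real \<Rightarrow> real" where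
  "gamma_mixture \<kappa> q w y = (\<Sum>k. gamma_mixture_term \<kappa> q w k y)"

lemma gamma_mixture_term_nonneg:
  "- 1 \<le> q \<Longrightarrow> 0 \<le> w \<Longrightarrow> 0 \<le> gamma_mixture_term \<kappa> q w k y"
  by (simp add: gamma_mixture_term_def rGamma_nonneg)

lemma gamma_mixture_measurable [measurable]: "gamma_mixture \<kappa> q w \<in> borel_measurable borel"
  unfolding gamma_mixture_def[abs_def] gamma_mixture_term_def by measurable

text \<open>
  Since \<open>rGamma s = s * rGamma (s + 1)\<close> and \<open>q + k + 1 \<ge> 1\<close> for \<open>k \<ge> 1\<close>, the values of \<open>rGamma\<close> decrease
  from the index \<open>1\<close> on, and the exponential series dominates.
\<close>

lemma summable_power_rGamma:
  fixes q z :: real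
  assumes "- 1 \<le> q" "0 \<le> z"
  shows "summable (\<lambda>k. z ^ k * rGamma (q + k + 1) / fact k)"
proof (rule summable_comparison_test)
  have step: "rGamma (q + Suc (Suc k) + 1) \<le> rGamma (q + Suc k + 1)" for k
  proof -
    have "rGamma (q + Suc k + 1) = (q + Suc k + 1) * rGamma (q + Suc k + 1 + 1)"
      by (simp only: rGamma_plus1)
    moreover have "1 * rGamma (q + Suc k + 1 + 1) \<le> (q + Suc k + 1) * rGamma (q + Suc k + 1 + 1)"
      using assms by (intro mult_right_mono rGamma_nonneg) auto
    ultimately show ?thesis by (simp add: add_ac)
  qed
  have bound: "rGamma (q + Suc k + 1) \<le> rGamma (q + 2)" for k
  proof (induction k)
    case (Suc k)
    then show ?case using step[of k] by simp
  qed (simp add: add_ac)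
  show "\<exists>N. \<forall>k\<ge>N. norm (z ^ k * rGamma (q + k + 1) / fact k) \<le> rGamma (q + 2) * (inverse (fact k) * z ^ k)"
  proof (intro exI allI impI)
    fix k :: nat assume "1 \<le> k"
    then obtain j where k: "k = Suc j" by (cases k) auto
    have "0 \<le> rGamma (q + k + 1)"
      using assms by (intro rGamma_nonneg) auto
    moreover have "rGamma (q + k + 1) * (z ^ k / fact k) \<le> rGamma (q + 2) * (z ^ k / fact k)"
      using bound[of j] assms unfolding k by (intro mult_right_mono) auto
    ultimately show "norm (z ^ k * rGamma (q + k + 1) / fact k) \<le> rGamma (q + 2) * (inverse (fact k) * z ^ k)"
      using assms by (simp add: field_simps)
  qed
  show "summable (\<lambda>k. rGamma (q + 2) * (inverse (fact k) * z ^ k))"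
    by (intro summable_mult summable_exp)
qed

lemma gamma_mixture_term_alt:
  assumes "0 < \<kappa>" "0 < y"
  shows "gamma_mixture_term \<kappa> q w k y
    = \<kappa> * exp (- w - \<kappa> * y) * (\<kappa> * y) powr q * ((w * (\<kappa> * y)) ^ k * rGamma (q + k + 1) / fact k)"
proof -
  have "\<kappa> powr (q + k + 1) = \<kappa> * \<kappa> powr q * \<kappa> ^ k" "y powr (q + k) = y powr q * y ^ k"
    using assms by (simp_all add: powr_add powr_realpow)
  then show ?thesis
    using assms by (simp add: gamma_mixture_term_def powr_mult exp_diff exp_minus power_mult_distrib field_simps)
qed

lemma summable_gamma_mixture:
  assumes "0 < \<kappa>" "0 < y" "- 1 \<le> q" "0 \<le> w"
  shows "summable (\<lambda>k. gamma_mixture_term \<kappa> q w k y)"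
  unfolding gamma_mixture_term_alt[OF assms(1,2)]
  using assms by (intro summable_mult summable_power_rGamma) auto

text \<open>
  A gamma law of shape \<open>s\<close> and rate \<open>\<kappa>\<close> has Laplace transform \<open>(\<kappa> / (\<kappa> + m)) powr s\<close>, and Poisson mixing
  sums these powers to an exponential. The subtracted term is the missing point mass for \<open>q = - 1\<close>.
\<close>

lemma nn_integral_gamma_mixture:
  assumes "0 < \<kappa>" "- 1 \<le> q" "0 \<le> w" "0 \<le> m"
  shows "(\<integral>\<^sup>+ y. ennreal (gamma_mixture \<kappa> q w y * exp (- (m * y))) * indicator {0<..} y \<partial>lborel) =
    ennreal ((\<kappa> / (\<kappa> + m)) powr (q + 1) * exp (w * (\<kappa> / (\<kappa> + m) - 1)) - (if q = - 1 then exp (- w) else 0))"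
proof -
  let ?r = "\<kappa> / (\<kappa> + m)"
  let ?T = "\<lambda>k y. gamma_mixture_term \<kappa> q w k y * exp (- (m * y))"
  let ?c = "\<lambda>k :: nat. if q + k + 1 = 0 then 0 else exp (- w) * (w ^ k / fact k) * ?r powr (q + k + 1)"
  have r: "0 < ?r" using assms by simp
  have [measurable]: "?T k \<in> borel_measurable borel" for k
    unfolding gamma_mixture_term_def by measurable
  have T: "(\<integral>\<^sup>+ y. ennreal (?T k y) * indicator {0<..} y \<partial>lborel) = ennreal (?c k)" for k
  proof (cases "q + k + 1 = 0")
    case True
    then show ?thesis by (simp add: gamma_mixture_term_def)
  next
    case False
    then have s: "0 < q + k + 1" using \<open>- 1 \<le> q\<close> by linarith
    define C where "C = exp (- w) * w ^ k / fact k * (\<kappa> powr (q + k + 1) * rGamma (q + k + 1))"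
    have C: "0 \<le> C"
      using s assms by (simp add: C_def rGamma_nonneg)
    have "(\<integral>\<^sup>+ y. ennreal (?T k y) * indicator {0<..} y \<partial>lborel) =
        (\<integral>\<^sup>+ y. ennreal C * (ennreal (y powr (q + k + 1 - 1) * exp (- ((\<kappa> + m) * y))) * indicator {0<..} y) \<partial>lborel)"
    proof (intro nn_integral_cong)
      fix y :: real
      have "exp (- ((\<kappa> + m) * y)) = exp (- (\<kappa> * y)) * exp (- (m * y))"
        by (simp add: exp_add[symmetric] distrib_right)
      then have "?T k y = C * (y powr (q + k + 1 - 1) * exp (- ((\<kappa> + m) * y)))"
        by (simp add: C_def gamma_mixture_term_def mult.assoc)
      then show "ennreal (?T k y) * indicator {0<..} y =
          ennreal C * (ennreal (y powr (q + k + 1 - 1) * exp (- ((\<kappa> + m) * y))) * indicator {0<..} y)"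
        by (simp only: ennreal_mult'[OF C] mult.assoc)
    qed
    also have "\<dots> = ennreal C * ennreal (Gamma (q + k + 1) / (\<kappa> + m) powr (q + k + 1))"
      using assms s by (subst nn_integral_cmult, measurable) (subst nn_integral_gamma_kernel, auto)
    also have "\<dots> = ennreal (C * (Gamma (q + k + 1) / (\<kappa> + m) powr (q + k + 1)))"
      by (rule ennreal_mult'[symmetric, OF C])
    also have "C * (Gamma (q + k + 1) / (\<kappa> + m) powr (q + k + 1)) =
        exp (- w) * (w ^ k / fact k) * (\<kappa> powr (q + k + 1) / (\<kappa> + m) powr (q + k + 1)) *
        (rGamma (q + k + 1) * Gamma (q + k + 1))"
      by (simp add: C_def)
    also have "rGamma (q + k + 1) * Gamma (q + k + 1) = 1"
      using Gamma_real_pos[OF s] by (simp add: rGamma_inverse_Gamma)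
    also have "exp (- w) * (w ^ k / fact k) * (\<kappa> powr (q + k + 1) / (\<kappa> + m) powr (q + k + 1)) * 1 = ?c k"
      using s assms by (simp add: powr_divide)
    finally show ?thesis .
  qed
  have expand: "ennreal (gamma_mixture \<kappa> q w y * exp (- (m * y))) * indicator {0<..} y =
      (\<Sum>k. ennreal (?T k y) * indicator {0<..} y)" for y
  proof (cases "0 < y")
    case True
    then show ?thesis
      using summable_gamma_mixture[OF \<open>0 < \<kappa>\<close> True \<open>- 1 \<le> q\<close> \<open>0 \<le> w\<close>] gamma_mixture_term_nonneg[OF assms(2,3)]
      by (simp add: gamma_mixture_def suminf_mult2 suminf_ennreal2 summable_mult2)
  qed simp
  have "(\<lambda>k. exp (- w) * ?r powr (q + 1) * ((w * ?r) ^ k /\<^sub>R fact k)) sums (exp (- w) * ?r powr (q + 1) * exp (w * ?r))"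
    by (intro sums_mult exp_converges)
  moreover have "exp (- w) * ?r powr (q + 1) * ((w * ?r) ^ k /\<^sub>R fact k) = exp (- w) * (w ^ k / fact k) * ?r powr (q + k + 1)" for k
  proof -
    have "?r powr (q + k + 1) = ?r powr (q + 1) * ?r ^ k"
      using r by (simp add: powr_add powr_realpow)
    then show ?thesis by (simp only: power_mult_distrib) (simp add: field_simps)
  qed
  moreover have "exp (- w) * ?r powr (q + 1) * exp (w * ?r) = ?r powr (q + 1) * exp (w * (?r - 1))"
    by (simp add: right_diff_distrib exp_diff exp_minus divide_inverse)
  ultimately have "(\<lambda>k. exp (- w) * (w ^ k / fact k) * ?r powr (q + k + 1)) sums (?r powr (q + 1) * exp (w * (?r - 1)))"
    by (simp only:)
  moreover have "(\<lambda>k. if k = 0 then (if q = - 1 then exp (- w) else 0) else 0) sums (if q = - 1 then exp (- w) else 0)"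
    by (rule sums_single)
  ultimately have "(\<lambda>k. exp (- w) * (w ^ k / fact k) * ?r powr (q + k + 1) - (if k = 0 then (if q = - 1 then exp (- w) else 0) else 0))
      sums (?r powr (q + 1) * exp (w * (?r - 1)) - (if q = - 1 then exp (- w) else 0))"
    by (rule sums_diff)
  moreover have "exp (- w) * (w ^ k / fact k) * ?r powr (q + k + 1) - (if k = 0 then (if q = - 1 then exp (- w) else 0) else 0) = ?c k" for k
    using r \<open>- 1 \<le> q\<close> by (auto)
  ultimately have sums: "?c sums (?r powr (q + 1) * exp (w * (?r - 1)) - (if q = - 1 then exp (- w) else 0))"
    by simp
  have "(\<integral>\<^sup>+ y. ennreal (gamma_mixture \<kappa> q w y * exp (- (m * y))) * indicator {0<..} y \<partial>lborel) =
     (\<Sum>k. \<integral>\<^sup>+ y. ennreal (?T k y) * indicator {0<..} y \<partial>lborel)"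
    unfolding expand by (intro nn_integral_suminf) measurable
  also have "\<dots> = (\<Sum>k. ennreal (?c k))"
    by (simp only: T)
  also have "\<dots> = ennreal (?r powr (q + 1) * exp (w * (?r - 1)) - (if q = - 1 then exp (- w) else 0))"
    using \<open>0 \<le> w\<close> by (intro suminf_ennreal_eq sums) auto
  finally show ?thesis .
qed

text \<open>
  Multiplying out the Bessel series, the prefactor \<open>(v / w) powr (q / 2)\<close> and the leading power
  \<open>sqrt (w * v) powr q\<close> combine to \<open>v powr q\<close>. For \<open>x = 0\<close> the Poisson weights are concentrated at \<open>k = 0\<close>.
\<close>

lemma cir_density_eq_gamma_mixture:
  fixes a \<sigma> \<theta> t x y :: real
  assumes "0 < a" "0 < \<sigma>" "0 \<le> \<theta>" "0 < t" "0 \<le> x" "0 < y"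
  shows "cir_density a \<sigma> \<theta> t x y =
    gamma_mixture (1 / cir_scale a \<sigma> t) (2 * a * \<theta> / \<sigma>\<^sup>2 - 1) (x * exp (- a * t) / cir_scale a \<sigma> t) y"
proof -
  define \<kappa> where "\<kappa> = 1 / cir_scale a \<sigma> t"
  define q where "q = 2 * a * \<theta> / \<sigma>\<^sup>2 - 1"
  define w where "w = x * exp (- a * t) / cir_scale a \<sigma> t"
  define v where "v = \<kappa> * y"
  have \<kappa>: "0 < \<kappa>" using cir_scale_pos assms by (simp add: \<kappa>_def)
  have v: "0 < v" using \<kappa> assms by (simp add: v_def)
  have q: "- 1 \<le> q" using assms by (simp add: q_def)
  have \<kappa>_eq: "2 * a / (\<sigma>\<^sup>2 * (1 - exp (- a * t))) = \<kappa>"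
    by (simp add: \<kappa>_def cir_scale_def)
  have w_eq: "\<kappa> * x * exp (- a * t) = w"
    by (simp add: \<kappa>_def w_def)
  have cir: "cir_density a \<sigma> \<theta> t x y =
      (if x > 0 then \<kappa> * exp (- w - v) * rpow (v / w) (q / 2) * bessel_I q (2 * sqrt (w * v))
       else \<kappa> * rGamma (q + 1) * rpow v q * exp (- v))"
    unfolding cir_density_def Let_def \<kappa>_eq w_eq q_def[symmetric] v_def by simp
  show ?thesis
    unfolding \<kappa>_def[symmetric] w_def[symmetric] q_def[symmetric]
  proof (cases "x = 0")
    case True
    then have [simp]: "w = 0" by (simp add: w_def)
    have "gamma_mixture \<kappa> q w y = (\<Sum>k\<in>{0}. gamma_mixture_term \<kappa> q w k y)"
      unfolding gamma_mixture_def by (intro suminf_finite) (auto simp: gamma_mixture_term_def)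
    then show "cir_density a \<sigma> \<theta> t x y = gamma_mixture \<kappa> q w y"
      unfolding cir using True v gamma_mixture_term_alt[OF \<kappa> \<open>0 < y\<close>, of q w 0]
      by (simp add: rpow_def v_def[symmetric])
  next
    case False
    then have x: "0 < x" using assms by simp
    have w: "0 < w" using x cir_scale_pos assms by (simp add: w_def)
    have "rpow (v / w) (q / 2) * rpow (sqrt (w * v)) q = (v / w) powr (q / 2) * (w * v) powr (q / 2)"
      using v w by (simp add: rpow_def powr_half_sqrt[symmetric] powr_powr)
    also have "\<dots> = (v * v) powr (q / 2)"
      using v w by (simp add: powr_mult[symmetric])
    also have "\<dots> = v powr q"
      using v by (simp add: powr_mult powr_add[symmetric])
    finally have pw: "rpow (v / w) (q / 2) * rpow (sqrt (w * v)) q = v powr q" .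
    have sq: "sqrt (w * v) ^ (2 * k) = (w * v) ^ k" for k
      using v w by (simp add: power_mult)
    have "cir_density a \<sigma> \<theta> t x y = \<kappa> * exp (- w - v) * (rpow (v / w) (q / 2) * rpow (sqrt (w * v)) q) *
        (\<Sum>k. (w * v) ^ k * rGamma (q + k + 1) / fact k)"
      using x by (simp add: cir bessel_I_def sq)
    also have "\<dots> = (\<Sum>k. \<kappa> * exp (- w - v) * v powr q * ((w * v) ^ k * rGamma (q + k + 1) / fact k))"
      unfolding pw using v w q by (intro suminf_mult[symmetric] summable_power_rGamma) auto
    also have "\<dots> = gamma_mixture \<kappa> q w y"
      unfolding gamma_mixture_def gamma_mixture_term_alt[OF \<kappa> \<open>0 < y\<close>] v_def ..
    finally show "cir_density a \<sigma> \<theta> t x y = gamma_mixture \<kappa> q w y" .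
  qed
qed

lemma rpow_measurable [measurable (raw)]:
  assumes [measurable]: "f \<in> borel_measurable M"
  shows "(\<lambda>x. rpow (f x) s) \<in> borel_measurable M"
  unfolding rpow_def by measurable

lemma cir_density_measurable [measurable]: "cir_density a \<sigma> \<theta> t x \<in> borel_measurable borel"
  unfolding cir_density_def[abs_def] Let_def bessel_I_def by measurable

text \<open>
  This is the transform of the CIR law, except that for \<open>\<theta> = 0\<close> that law has an atom at \<open>0\<close> which the
  density does not see.
\<close>

lemma nn_integral_cir_density_laplace:
  fixes a \<sigma> \<theta> t x :: real
  assumes "0 < a" "0 < \<sigma>" "0 \<le> \<theta>" "0 < t" "0 \<le> x"
  shows "(\<integral>\<^sup>+ y. ennreal (cir_density a \<sigma> \<theta> t x y * exp (- (real n * y))) * indicator {0<..} y \<partial>lborel) =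
    ennreal ((1 + real n * cir_scale a \<sigma> t) powr (- 2 * a * \<theta> / \<sigma>\<^sup>2) * exp (- (x * laplace_exponent a \<sigma> n t))
      - (if \<theta> = 0 then exp (- (x * jump_rate a \<sigma> t)) else 0))"
proof -
  let ?b = "cir_scale a \<sigma> t"
  have b: "0 < ?b" using assms cir_scale_pos by simp
  have nb: "0 < 1 + real n * ?b" using b by (simp add: add_pos_nonneg)
  have r: "(1 / ?b) / (1 / ?b + real n) = 1 / (1 + real n * ?b)"
    using b nb by (simp add: field_simps)
  have w0: "0 \<le> x * jump_rate a \<sigma> t"
    using b assms by (simp add: jump_rate_def)
  have q: "- 1 \<le> 2 * a * \<theta> / \<sigma>\<^sup>2 - 1" "(2 * a * \<theta> / \<sigma>\<^sup>2 - 1 = - 1) = (\<theta> = 0)"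
    using assms by auto
  have pw: "(1 / (1 + real n * ?b)) powr (2 * a * \<theta> / \<sigma>\<^sup>2 - 1 + 1) = (1 + real n * ?b) powr (- 2 * a * \<theta> / \<sigma>\<^sup>2)"
    using nb by (simp add: powr_minus powr_divide divide_simps)
  have ex: "x * jump_rate a \<sigma> t * (1 / (1 + real n * ?b) - 1) = - (x * laplace_exponent a \<sigma> n t)"
    by (simp add: laplace_exponent_eq[OF b] algebra_simps)
  have "(\<integral>\<^sup>+ y. ennreal (cir_density a \<sigma> \<theta> t x y * exp (- (real n * y))) * indicator {0<..} y \<partial>lborel)
     = (\<integral>\<^sup>+ y. ennreal (gamma_mixture (1 / ?b) (2 * a * \<theta> / \<sigma>\<^sup>2 - 1) (x * jump_rate a \<sigma> t) y * exp (- (real n * y)))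
          * indicator {0<..} y \<partial>lborel)"
    using assms by (intro nn_integral_cong)
      (auto simp: cir_density_eq_gamma_mixture jump_rate_def split: split_indicator)
  also have "\<dots> = ennreal ((1 / (1 + real n * ?b)) powr (2 * a * \<theta> / \<sigma>\<^sup>2 - 1 + 1) *
      exp (x * jump_rate a \<sigma> t * (1 / (1 + real n * ?b) - 1))
      - (if 2 * a * \<theta> / \<sigma>\<^sup>2 - 1 = - 1 then exp (- (x * jump_rate a \<sigma> t)) else 0))"
    using b q(1) w0 by (subst nn_integral_gamma_mixture) (simp_all only: r, simp_all)
  finally show ?thesis
    unfolding pw ex q(2) .
qed

lemma cir_density_nonneg:
  fixes a \<sigma> \<theta> t x y :: real
  assumes "0 < a" "0 < \<sigma>" "0 \<le> \<theta>" "0 < t" "0 \<le> x" "0 < y"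
  shows "0 \<le> cir_density a \<sigma> \<theta> t x y"
proof -
  have b: "0 < cir_scale a \<sigma> t" using assms cir_scale_pos by simp
  have "0 \<le> gamma_mixture_term (1 / cir_scale a \<sigma> t) (2 * a * \<theta> / \<sigma>\<^sup>2 - 1) (x * exp (- a * t) / cir_scale a \<sigma> t) k y" for k
    using b assms by (intro gamma_mixture_term_nonneg) auto
  moreover have "summable (\<lambda>k. gamma_mixture_term (1 / cir_scale a \<sigma> t) (2 * a * \<theta> / \<sigma>\<^sup>2 - 1) (x * exp (- a * t) / cir_scale a \<sigma> t) k y)"
    using b assms by (intro summable_gamma_mixture) auto
  ultimately show ?thesis
    unfolding cir_density_eq_gamma_mixture[OF assms] gamma_mixture_def by (intro suminf_nonneg)
qed

section \<open>The jump part\<close>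

text \<open>
  The contribution to the exponent of one jump of size \<open>\<xi>\<close>, with the mass at \<open>0\<close> removed: it is the Laplace
  transform of the part of a \<open>\<theta> = 0\<close> diffusion that has survived.
\<close>

lemma completely_monotone_single_jump:
  assumes "0 < cir_scale a \<sigma> s" "0 \<le> \<xi>"
  shows "completely_monotone (\<lambda>n. exp (- (\<xi> * laplace_exponent a \<sigma> n s)) - exp (- (\<xi> * jump_rate a \<sigma> s)))"
proof -
  let ?\<beta> = "jump_rate a \<sigma> s" and ?r = "\<lambda>n. 1 / (1 + real n * cir_scale a \<sigma> s)"
  have "0 \<le> \<xi> * ?\<beta>"
    using assms by (simp add: jump_rate_def)
  then have "completely_monotone (\<lambda>n. exp (- (\<xi> * ?\<beta>)) * (exp (\<xi> * ?\<beta> * ?r n) - 1))"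
    using assms(1)
    by (intro completely_monotone_cmult completely_monotone_exp_minus_1 completely_monotone_inverse_linear) auto
  then show ?thesis
    by (simp add: laplace_exponent_eq[OF assms(1)] right_diff_distrib exp_add[symmetric] algebra_simps)
qed

lemma jump_rate_le:
  assumes "0 < a" "0 < \<sigma>" "0 < s"
  shows "jump_rate a \<sigma> s \<le> 2 / \<sigma>\<^sup>2 / s"
proof -
  have "jump_rate a \<sigma> s = (2 * a / \<sigma>\<^sup>2) / (exp (a * s) - 1)"
    using assms by (simp add: jump_rate_def cir_scale_def exp_minus divide_simps)
  also have "\<dots> \<le> (2 * a / \<sigma>\<^sup>2) / (a * s)"
  proof (rule divide_left_mono)
    show "a * s \<le> exp (a * s) - 1"
      using exp_ge_add_one_self[of "a * s"] by linarith
  qed (use assms in auto)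
  also have "\<dots> = 2 / \<sigma>\<^sup>2 / s"
    using assms by simp
  finally show ?thesis .
qed

lemma laplace_exponent_measurable [measurable]: "laplace_exponent a \<sigma> n \<in> borel_measurable borel"
  unfolding laplace_exponent_def[abs_def] cir_scale_def by measurable

lemma jump_rate_measurable [measurable]: "jump_rate a \<sigma> \<in> borel_measurable borel"
  unfolding jump_rate_def[abs_def] cir_scale_def by measurable

text \<open>
  For a small jump the integrand is at most \<open>1\<close> up to time \<open>\<xi>\<close>, and afterwards at most a multiple of
  \<open>\<xi> / s\<close>, whose integral from \<open>\<xi>\<close> to \<open>t\<close> produces the logarithm. For \<open>\<xi> \<ge> 1\<close> the trivial bound \<open>t\<close> is
  enough.
\<close>

lemma nn_integral_jump_rate_le:
  assumes "0 < a" "0 < \<sigma>" "0 < t" "0 < \<xi>"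
  shows "(\<integral>\<^sup>+ s. ennreal (1 - exp (- (\<xi> * jump_rate a \<sigma> s))) * indicator {0<..t} s \<partial>lborel)
    \<le> ennreal ((t + 1 + 2 / \<sigma>\<^sup>2 * \<bar>ln t\<bar>) * min \<xi> 1) + ennreal (2 / \<sigma>\<^sup>2) * (ennreal (\<xi> * ln (1 / \<xi>)) * indicator {0<..<1} \<xi>)"
proof (cases "1 \<le> \<xi>")
  case True
  have "(\<integral>\<^sup>+ s. ennreal (1 - exp (- (\<xi> * jump_rate a \<sigma> s))) * indicator {0<..t} s \<partial>lborel)
      \<le> (\<integral>\<^sup>+ s. indicator {0<..t} s \<partial>lborel)"
    by (intro nn_integral_mono) (auto split: split_indicator intro!: ennreal_le_1[THEN iffD2])
  also have "\<dots> = ennreal t"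
    using assms by simp
  also have "\<dots> \<le> ennreal ((t + 1 + 2 / \<sigma>\<^sup>2 * \<bar>ln t\<bar>) * min \<xi> 1)"
    using True assms by (intro ennreal_leI) simp
  finally show ?thesis
    using True by simp
next
  case False
  define K where "K = 2 / \<sigma>\<^sup>2"
  have K: "0 \<le> K" by (simp add: K_def)
  have pt: "ennreal (1 - exp (- (\<xi> * jump_rate a \<sigma> s))) * indicator {0<..t} s
      \<le> indicator {0<..\<xi>} s + ennreal (K * \<xi> / s) * indicator {\<xi>..t} s" for s
  proof (cases "0 < s \<and> s \<le> t")
    case s: True
    show ?thesis
    proof (cases "s \<le> \<xi>")
      case True
      then have "ennreal (1 - exp (- (\<xi> * jump_rate a \<sigma> s))) * indicator {0<..t} s \<le> indicator {0<..\<xi>} s"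
        using s by (auto intro!: ennreal_le_1[THEN iffD2])
      then show ?thesis by (rule add_increasing2[rotated]) simp
    next
      case False
      have "1 - exp (- (\<xi> * jump_rate a \<sigma> s)) \<le> \<xi> * jump_rate a \<sigma> s"
        using exp_ge_add_one_self[of "- (\<xi> * jump_rate a \<sigma> s)"] by simp
      also have "\<dots> \<le> \<xi> * (K / s)"
        using jump_rate_le[of a \<sigma> s] s assms by (intro mult_left_mono) (auto simp: K_def)
      finally show ?thesis
        using s False by (auto intro!: ennreal_leI simp: mult.commute)
    qed
  qed simp
  have tail: "(\<integral>\<^sup>+ s. ennreal (K * \<xi> / s) * indicator {\<xi>..t} s \<partial>lborel) \<le> ennreal (K * \<xi> * (\<bar>ln t\<bar> + ln (1 / \<xi>)))"
  proof (cases "\<xi> \<le> t")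
    case True
    have "(\<integral>\<^sup>+ s. ennreal (K * \<xi> / s) * indicator {\<xi>..t} s \<partial>lborel) = ennreal (K * \<xi> * ln t - K * \<xi> * ln \<xi>)"
    proof (rule nn_integral_FTC_Icc[OF _ _ _ True])
      show "DERIV (\<lambda>s. K * \<xi> * ln s) s :> K * \<xi> / s" if "s \<in> {\<xi>..t}" for s
        using that assms by (auto intro!: derivative_eq_intros)
      show "0 \<le> K * \<xi> / s" if "s \<in> {\<xi>..t}" for s
        using that assms K by auto
    qed measurable
    also have "\<dots> \<le> ennreal (K * \<xi> * (\<bar>ln t\<bar> + ln (1 / \<xi>)))"
      using assms K by (intro ennreal_leI) (simp add: ln_div right_diff_distrib[symmetric] divide_right_mono mult_left_mono del: times_divide_eq_left)
    finally show ?thesis .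
  qed simp
  have split: "ennreal \<xi> + ennreal (K * \<xi> * (c + l)) = ennreal (\<xi> + K * \<xi> * c) + ennreal (K * (\<xi> * l))"
    if "0 \<le> c" "0 \<le> l" for c l
    using that K assms by (subst (1 2) ennreal_plus[symmetric]) (auto simp: distrib_left mult.assoc)
  have "(\<integral>\<^sup>+ s. ennreal (1 - exp (- (\<xi> * jump_rate a \<sigma> s))) * indicator {0<..t} s \<partial>lborel)
      \<le> (\<integral>\<^sup>+ s. indicator {0<..\<xi>} s + ennreal (K * \<xi> / s) * indicator {\<xi>..t} s \<partial>lborel)"
    by (intro nn_integral_mono pt)
  also have "\<dots> = ennreal \<xi> + (\<integral>\<^sup>+ s. ennreal (K * \<xi> / s) * indicator {\<xi>..t} s \<partial>lborel)"
    using assms by (subst nn_integral_add) auto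
  also have "\<dots> \<le> ennreal \<xi> + ennreal (K * \<xi> * (\<bar>ln t\<bar> + ln (1 / \<xi>)))"
    by (intro add_left_mono tail)
  also have "\<dots> = ennreal (\<xi> + K * \<xi> * \<bar>ln t\<bar>) + ennreal (K * (\<xi> * ln (1 / \<xi>)))"
  proof (rule split)
    show "0 \<le> ln (1 / \<xi>)"
      using assms False by (intro ln_ge_zero) (simp add: le_divide_eq)
  qed simp
  also have "\<dots> \<le> ennreal ((t + 1 + K * \<bar>ln t\<bar>) * min \<xi> 1) + ennreal (K * (\<xi> * ln (1 / \<xi>)))"
    using assms False by (intro add_right_mono ennreal_leI) (simp add: algebra_simps)
  also have "ennreal (K * (\<xi> * ln (1 / \<xi>))) = ennreal K * (ennreal (\<xi> * ln (1 / \<xi>)) * indicator {0<..<1} \<xi>)"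
    using assms False K by (simp add: ennreal_mult')
  finally show ?thesis by (simp only: K_def)
qed

text \<open>
  By Markov's inequality for \<open>min \<xi> 1\<close> the measure is finite away from \<open>0\<close>. This is what Tonelli's theorem
  needs in the estimate of the jump exponent.
\<close>

lemma positive_levy_measure_sigma_finite:
  assumes "positive_levy_measure \<nu>"
  shows "sigma_finite_measure \<nu>"
proof
  have sets [measurable_cong]: "sets \<nu> = sets borel" and null: "emeasure \<nu> {..0} = 0"
    and int: "(\<integral>\<^sup>+ \<xi>\<in>{0<..}. ennreal (min \<xi> 1) \<partial>\<nu>) < \<infinity>"
    using assms by (auto simp: positive_levy_measure_def)
  have space: "space \<nu> = UNIV" using sets_eq_imp_space_eq[OF sets] by simp
  have fin: "emeasure \<nu> {e..} \<noteq> \<infinity>" if "0 < e" "e \<le> 1" for e :: real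
  proof
    assume "emeasure \<nu> {e..} = \<infinity>"
    then have "\<infinity> = ennreal e * emeasure \<nu> {e..}" using that by (simp add: ennreal_mult_top)
    also have "\<dots> = (\<integral>\<^sup>+ \<xi>. ennreal e * indicator {e..} \<xi> \<partial>\<nu>)"
      by (subst nn_integral_cmult_indicator) (auto simp: sets)
    also have "\<dots> \<le> (\<integral>\<^sup>+ \<xi>\<in>{0<..}. ennreal (min \<xi> 1) \<partial>\<nu>)"
      using that by (intro nn_integral_mono) (auto split: split_indicator intro!: ennreal_leI)
    finally show False using int by (simp add: top_unique)
  qed
  let ?A = "insert {..0} (range (\<lambda>k. {1 / real (Suc k)..}))"
  have "x \<in> \<Union>?A" for x :: real
  proof (cases "0 < x")
    case True
    then obtain k where "inverse (real (Suc k)) < x" using reals_Archimedean by blast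
    then show ?thesis by (auto simp: inverse_eq_divide intro: less_imp_le)
  qed auto
  then show "\<exists>A. countable A \<and> A \<subseteq> sets \<nu> \<and> \<Union>A = space \<nu> \<and> (\<forall>a\<in>A. emeasure \<nu> a \<noteq> \<infinity>)"
    using null fin by (intro exI[of _ ?A]) (auto simp: sets space)
qed

text \<open>
  Here \<open>\<Lambda>\<close> is the integral of \<open>1 - exp (- (\<xi> * jump_rate a \<sigma> s))\<close> over \<open>0 < s \<le> t\<close> and all jumps \<open>\<xi>\<close>. It
  is finite by the logarithmic moment and dominates the integrand of the exponent, so that the
  remainder \<open>\<eta>\<close> is an integral of the sequences of \<open>completely_monotone_single_jump\<close>. Neither depends on the
  starting point of the process.
\<close>

lemma jump_exponent_completely_monotone:
  fixes a \<sigma> t :: real and \<nu> :: "real measure"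
  assumes "0 < a" "0 < \<sigma>" "0 < t" and levy: "positive_levy_measure \<nu>"
    and log_moment: "(\<integral>\<^sup>+ \<xi>\<in>{0<..<1}. ennreal (\<xi> * ln (1 / \<xi>)) \<partial>\<nu>) < \<infinity>"
  obtains \<Lambda> \<eta> where "completely_monotone \<eta>"
    and "\<And>n. (LINT s:{0..t}|lborel. LINT \<xi>:{0<..}|\<nu>. exp (of_real \<xi> * jcir_psi a \<sigma> s (- of_nat n)) - 1)
        = complex_of_real (\<eta> n - \<Lambda>)"
proof -
  have sets [measurable_cong]: "sets \<nu> = sets borel"
    and int: "(\<integral>\<^sup>+ \<xi>\<in>{0<..}. ennreal (min \<xi> 1) \<partial>\<nu>) < \<infinity>"
    using levy by (auto simp: positive_levy_measure_def)
  define V where "V = restrict_space \<nu> {0<..}"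
  define L where "L = restrict_space lborel {0<..t}"
  have setsV [measurable_cong]: "sets V = sets (restrict_space borel {0<..})"
    unfolding V_def by (intro sets_restrict_space_cong sets)
  have setsL [measurable_cong]: "sets L = sets (restrict_space borel {0<..t})"
    unfolding L_def by (intro sets_restrict_space_cong) simp
  have sp: "space L = {0<..t}" "space V = {0<..}"
    by (simp_all add: L_def V_def space_restrict_space sets_eq_imp_space_eq[OF sets])
  have mV: "{0<..} \<inter> space \<nu> \<in> sets \<nu>" by (simp add: sets sets_eq_imp_space_eq[OF sets])
  interpret V: sigma_finite_measure V
    unfolding V_def using positive_levy_measure_sigma_finite[OF levy]
    by (intro sigma_finite_measure_restrict_space) (simp_all add: sets)
  interpret L: sigma_finite_measure L
    unfolding L_def by (intro sigma_finite_measure_restrict_space sigma_finite_lborel) simp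
  interpret P: pair_sigma_finite L V ..
  have idL [measurable]: "(\<lambda>s. s) \<in> borel_measurable L" and idV [measurable]: "(\<lambda>s. s) \<in> borel_measurable V"
    by (simp_all add: measurable_cong_sets[OF setsL refl] measurable_cong_sets[OF setsV refl] measurable_restrict_space1)
  let ?P = "L \<Otimes>\<^sub>M V"
  have mf [measurable]: "fst \<in> borel_measurable ?P" and ms [measurable]: "snd \<in> borel_measurable ?P"
    using measurable_compose[OF measurable_fst idL] measurable_compose[OF measurable_snd idV] by simp_all
  have meas: "(\<lambda>z. 1 - exp (- (g z * f z))) \<in> borel_measurable ?P"
    if [measurable]: "f \<in> borel_measurable ?P" "g \<in> borel_measurable ?P" for f g :: "real \<times> real \<Rightarrow> real"
    by measurable
  let ?J = "\<lambda>z. 1 - exp (- (snd z * jump_rate a \<sigma> (fst z)))"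
  let ?E = "\<lambda>n z. 1 - exp (- (snd z * laplace_exponent a \<sigma> n (fst z)))"
  have space: "0 < fst z \<and> 0 < snd z \<and> 0 < cir_scale a \<sigma> (fst z)" if "z \<in> space ?P" for z
    using that cir_scale_pos assms by (auto simp: space_pair_measure sp)
  have J0: "0 \<le> ?J z" if "z \<in> space ?P" for z
    using space[OF that] by (simp add: jump_rate_def)
  have EJ: "0 \<le> ?E n z \<and> ?E n z \<le> ?J z" if "z \<in> space ?P" for n z
    using space[OF that] completely_monotone_nonneg[OF completely_monotone_single_jump, of a \<sigma> "fst z" "snd z" n]
    by (auto simp: laplace_exponent_def)
  have "(\<integral>\<^sup>+ z. ennreal (?J z) \<partial>?P) = (\<integral>\<^sup>+ \<xi>. \<integral>\<^sup>+ s. ennreal (1 - exp (- (\<xi> * jump_rate a \<sigma> s))) \<partial>L \<partial>V)"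
    by (subst P.nn_integral_snd[symmetric]) simp_all
  also have "\<dots> \<le> (\<integral>\<^sup>+ \<xi>. ennreal ((t + 1 + 2 / \<sigma>\<^sup>2 * \<bar>ln t\<bar>) * min \<xi> 1) +
      ennreal (2 / \<sigma>\<^sup>2) * (ennreal (\<xi> * ln (1 / \<xi>)) * indicator {0<..<1} \<xi>) \<partial>V)"
  proof (intro nn_integral_mono)
    fix \<xi> assume "\<xi> \<in> space V"
    then have "0 < \<xi>" by (simp add: sp)
    from nn_integral_jump_rate_le[OF assms(1-3) this]
    show "(\<integral>\<^sup>+ s. ennreal (1 - exp (- (\<xi> * jump_rate a \<sigma> s))) \<partial>L) \<le> ennreal ((t + 1 + 2 / \<sigma>\<^sup>2 * \<bar>ln t\<bar>) * min \<xi> 1) +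
        ennreal (2 / \<sigma>\<^sup>2) * (ennreal (\<xi> * ln (1 / \<xi>)) * indicator {0<..<1} \<xi>)"
      by (simp add: L_def nn_integral_restrict_space)
  qed
  also have "\<dots> = ennreal (t + 1 + 2 / \<sigma>\<^sup>2 * \<bar>ln t\<bar>) * (\<integral>\<^sup>+ \<xi>. ennreal (min \<xi> 1) \<partial>V)
      + ennreal (2 / \<sigma>\<^sup>2) * (\<integral>\<^sup>+ \<xi>. ennreal (\<xi> * ln (1 / \<xi>)) * indicator {0<..<1} \<xi> \<partial>V)"
    using assms by (simp add: nn_integral_add nn_integral_cmult ennreal_mult')
  also have "(\<integral>\<^sup>+ \<xi>. ennreal (\<xi> * ln (1 / \<xi>)) * indicator {0<..<1} \<xi> \<partial>V)
      = (\<integral>\<^sup>+ \<xi>\<in>{0<..<1}. ennreal (\<xi> * ln (1 / \<xi>)) \<partial>\<nu>)"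
    unfolding V_def by (subst nn_integral_restrict_space[OF mV]) (auto intro!: nn_integral_cong split: split_indicator)
  also have "(\<integral>\<^sup>+ \<xi>. ennreal (min \<xi> 1) \<partial>V) = (\<integral>\<^sup>+ \<xi>\<in>{0<..}. ennreal (min \<xi> 1) \<partial>\<nu>)"
    unfolding V_def by (subst nn_integral_restrict_space[OF mV]) simp
  finally have "(\<integral>\<^sup>+ z. ennreal (?J z) \<partial>?P) < \<infinity>"
    by (rule le_less_trans) (use int log_moment in \<open>simp add: ennreal_mult_less_top\<close>)
  then have J: "integrable ?P ?J"
    using J0 by (intro integrableI_nonneg AE_I2 meas measurable_compose[OF mf jump_rate_measurable] ms) simp_all
  have E: "integrable ?P (?E n)" for n
    using EJ J0 by (intro Bochner_Integration.integrable_bound[OF J] meas AE_I2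
        measurable_compose[OF mf laplace_exponent_measurable] ms) (force simp only: real_norm_def abs_of_nonneg)
  have "completely_monotone (\<lambda>n. \<integral>z. ?J z - ?E n z \<partial>?P)"
  proof (rule completely_monotone_integral)
    show "integrable ?P (\<lambda>z. ?J z - ?E n z)" for n
      by (intro Bochner_Integration.integrable_diff J E)
    show "completely_monotone (\<lambda>n. ?J z - ?E n z)" if "z \<in> space ?P" for z
      using space[OF that] completely_monotone_single_jump[of a \<sigma> "fst z" "snd z"] by simp
  qed
  then have cm: "completely_monotone (\<lambda>n. (\<integral>z. ?J z \<partial>?P) - (\<integral>z. ?E n z \<partial>?P))"
    by (simp only: Bochner_Integration.integral_diff[OF J E])
  have inner: "(LINT \<xi>:{0<..}|\<nu>. exp (of_real \<xi> * jcir_psi a \<sigma> s (- of_nat n)) - 1)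
      = complex_of_real (\<integral>\<xi>. exp (- (\<xi> * laplace_exponent a \<sigma> n s)) - 1 \<partial>V)" for s n
  proof -
    have "(LINT \<xi>:{0<..}|\<nu>. exp (of_real \<xi> * jcir_psi a \<sigma> s (- of_nat n)) - 1)
      = (\<integral>\<xi>. complex_of_real (exp (- (\<xi> * laplace_exponent a \<sigma> n s)) - 1) \<partial>V)"
      unfolding V_def set_lebesgue_integral_def integral_restrict_space[OF mV] jcir_psi_neg_nat
      by (simp add: exp_of_real[symmetric])
    then show ?thesis by (simp only: integral_complex_of_real)
  qed
  \<comment> \<open>At \<open>s = 0\<close> the rate \<open>jump_rate\<close> has denominator \<open>0\<close>; this single time is a null set.\<close>
  have outer: "(LINT s:{0..t}|lborel. complex_of_real (g s)) = complex_of_real (\<integral>s. g s \<partial>L)"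
    if g [measurable]: "g \<in> borel_measurable borel" for g
  proof -
    have "(LINT s:{0..t}|lborel. complex_of_real (g s)) = (LINT s:{0<..t}|lborel. complex_of_real (g s))"
      using AE_lborel_singleton[of 0] unfolding set_lebesgue_integral_def
      by (intro integral_cong_AE) (auto split: split_indicator)
    also have "\<dots> = (\<integral>s. complex_of_real (g s) \<partial>L)"
      unfolding L_def set_lebesgue_integral_def by (subst integral_restrict_space) simp_all
    finally show ?thesis by (simp only: integral_complex_of_real)
  qed
  have "(LINT s:{0..t}|lborel. LINT \<xi>:{0<..}|\<nu>. exp (of_real \<xi> * jcir_psi a \<sigma> s (- of_nat n)) - 1)
      = complex_of_real (((\<integral>z. ?J z \<partial>?P) - (\<integral>z. ?E n z \<partial>?P)) - (\<integral>z. ?J z \<partial>?P))" for n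
  proof -
    have "(\<integral>s. \<integral>\<xi>. exp (- (\<xi> * laplace_exponent a \<sigma> n s)) - 1 \<partial>V \<partial>L) = (\<integral>z. - ?E n z \<partial>?P)"
      using P.integral_fst'[OF Bochner_Integration.integrable_minus[OF E[of n]]] by simp
    also have "\<dots> = - (\<integral>z. ?E n z \<partial>?P)"
      by (rule integral_minus)
    finally have "(\<integral>s. \<integral>\<xi>. exp (- (\<xi> * laplace_exponent a \<sigma> n s)) - 1 \<partial>V \<partial>L) = - (\<integral>z. ?E n z \<partial>?P)" .
    moreover have "(\<lambda>s. \<integral>\<xi>. exp (- (\<xi> * laplace_exponent a \<sigma> n s)) - 1 \<partial>V) \<in> borel_measurable borel"
      by measurable
    ultimately show ?thesis
      unfolding inner by (subst outer) simp_all
  qed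
  with cm show thesis by (rule that)
qed

lemma jcir_transform_neg_nat:
  fixes a \<sigma> \<theta> t x \<Lambda> :: real and \<eta> :: "nat \<Rightarrow> real"
  assumes "0 < cir_scale a \<sigma> t"
    and jump: "(LINT s:{0..t}|lborel. LINT \<xi>:{0<..}|\<nu>. exp (of_real \<xi> * jcir_psi a \<sigma> s (- of_nat n)) - 1)
        = complex_of_real (\<eta> n - \<Lambda>)"
  shows "jcir_transform a \<sigma> \<theta> \<nu> t x (- of_nat n) = complex_of_real
     ((1 + real n * cir_scale a \<sigma> t) powr (- 2 * a * \<theta> / \<sigma>\<^sup>2) * exp (- (x * laplace_exponent a \<sigma> n t)) * exp (\<eta> n - \<Lambda>))"
proof -
  have "0 \<le> 1 + real n * cir_scale a \<sigma> t" using assms by simp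
  then show ?thesis
    unfolding jcir_transform_def jump unfolding transform_denominator jcir_psi_neg_nat
    by (simp only: powr_of_real of_real_mult exp_of_real[symmetric] of_real_minus mult_minus_right)
qed

section \<open>Comparison of the transition densities\<close>

text \<open>
  With \<open>L\<close> the transform of the CIR law and \<open>\<delta>\<close> its mass at \<open>0\<close>, the density has transform \<open>L n - \<delta>\<close>, and
  \<open>L n * exp (\<eta> n - \<Lambda>) - exp (- \<Lambda>) * (L n - \<delta>) = exp (- \<Lambda>) * (L n * (exp (\<eta> n) - 1) + \<delta>)\<close>
  is completely monotone.
\<close>

lemma cir_density_le_jcir_law:
  fixes a \<sigma> \<theta> t x \<Lambda> :: real and \<eta> :: "nat \<Rightarrow> real" and N :: "real measure"
  assumes pos: "0 < a" "0 < \<sigma>" "0 \<le> \<theta>" "0 < t" "0 \<le> x"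
    and \<eta>: "completely_monotone \<eta>"
    and "finite_measure N" and setsN [measurable_cong]: "sets N = sets borel" and N0: "AE y in N. 0 \<le> y"
    and N: "\<And>n. (\<integral>y. exp (- (real n * y)) \<partial>N) =
      (1 + real n * cir_scale a \<sigma> t) powr (- 2 * a * \<theta> / \<sigma>\<^sup>2) * exp (- (x * laplace_exponent a \<sigma> n t)) * exp (\<eta> n - \<Lambda>)"
    and A [measurable]: "A \<in> sets borel"
  shows "(\<integral>\<^sup>+ y. ennreal (exp (- \<Lambda>) * cir_density a \<sigma> \<theta> t x y) * indicator ({0<..} \<inter> A) y \<partial>lborel) \<le> emeasure N A"
proof -
  let ?f = "\<lambda>y. exp (- \<Lambda>) * cir_density a \<sigma> \<theta> t x y"
  let ?L = "\<lambda>n. (1 + real n * cir_scale a \<sigma> t) powr (- 2 * a * \<theta> / \<sigma>\<^sup>2) * exp (- (x * laplace_exponent a \<sigma> n t))"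
  define \<delta> where "\<delta> = (if \<theta> = 0 then exp (- (x * jump_rate a \<sigma> t)) else 0)"
  have \<delta>: "0 \<le> \<delta>" by (simp add: \<delta>_def)
  have b: "0 < cir_scale a \<sigma> t" using pos cir_scale_pos by simp
  have L\<delta>: "0 \<le> ?L n - \<delta>" for n
  proof (cases "\<theta> = 0")
    case True
    have "laplace_exponent a \<sigma> n t \<le> jump_rate a \<sigma> t"
      unfolding laplace_exponent_eq[OF b] using b by (simp add: jump_rate_def)
    moreover have "1 + real n * cir_scale a \<sigma> t \<noteq> 0"
      using b by (smt (verit) mult_nonneg_nonneg of_nat_0_le_iff)
    ultimately show ?thesis using True pos
      by (simp add: \<delta>_def mult_left_mono)
  qed (simp add: \<delta>_def)
  define K where "K = density lborel (\<lambda>y. ennreal (?f y) * indicator {0<..} y)"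
  have nnK: "(\<integral>\<^sup>+ y. ennreal (exp (- (real n * y))) \<partial>K) = ennreal (exp (- \<Lambda>) * (?L n - \<delta>))" for n
  proof -
    have "(\<integral>\<^sup>+ y. ennreal (exp (- (real n * y))) \<partial>K) = (\<integral>\<^sup>+ y. ennreal (exp (- \<Lambda>)) *
        (ennreal (cir_density a \<sigma> \<theta> t x y * exp (- (real n * y))) * indicator {0<..} y) \<partial>lborel)"
      unfolding K_def using cir_density_nonneg[OF pos]
      by (subst nn_integral_density, measurable)
        (auto intro!: nn_integral_cong simp: ennreal_mult'[symmetric] ennreal_mult''[symmetric] mult.assoc split: split_indicator)
    also have "\<dots> = ennreal (exp (- \<Lambda>)) * ennreal (?L n - \<delta>)"
      by (subst nn_integral_cmult, measurable) (simp only: nn_integral_cir_density_laplace[OF pos] \<delta>_def)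
    finally show ?thesis by (simp add: ennreal_mult')
  qed
  have lapK: "(\<integral>y. exp (- (real n * y)) \<partial>K) = exp (- \<Lambda>) * (?L n - \<delta>)" for n
  proof -
    have "(\<integral>y. exp (- (real n * y)) \<partial>K) = enn2real (\<integral>\<^sup>+ y. ennreal (exp (- (real n * y))) \<partial>K)"
      by (intro integral_eq_nn_integral) (auto simp: K_def)
    then show ?thesis
      unfolding nnK using L\<delta>[of n] by simp
  qed
  have finK: "finite_measure K"
    using nnK[of 0] by (intro finite_measureI) (simp add: K_def)
  have K0: "AE y in K. 0 \<le> y"
    unfolding K_def by (subst AE_density) (auto split: split_indicator)
  \<comment> \<open>The integrand is cut off outside the support so that it is completely monotone at every point.\<close>
  have cmK: "completely_monotone (\<lambda>n. \<integral>y. exp (- (real n * y)) \<partial>K)"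
  proof -
    have cm: "completely_monotone (\<lambda>n. if 0 \<le> y then exp (- (real n * y)) else 0)" for y :: real
      using completely_monotone_geometric[of "exp (- y)"] completely_monotone_const[of 0]
      by (cases "0 \<le> y") (auto simp: exp_of_nat_mult[symmetric])
    have "(\<integral>y. exp (- (real n * y)) \<partial>K) = (\<integral>y. (if 0 \<le> y then exp (- (real n * y)) else 0) \<partial>K)" for n
      using K0 by (intro integral_cong_AE) (auto simp: K_def)
    moreover have "integrable K (\<lambda>y. if 0 \<le> y then exp (- (real n * y)) else 0)" for n
      by (intro finite_measure.integrable_const_bound[OF finK, where B = 1]) (auto simp: K_def)
    ultimately show ?thesis
      using completely_monotone_integral[of K "\<lambda>y n. if 0 \<le> y then exp (- (real n * y)) else 0"] cm
      by simp
  qed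
  have "completely_monotone (\<lambda>n. (\<integral>y. exp (- (real n * y)) \<partial>K) * (exp (\<eta> n) - 1)
      + exp (- \<Lambda>) * \<delta> * (exp (\<eta> n) - 1) + exp (- \<Lambda>) * \<delta>)"
    using \<delta> by (intro completely_monotone_add completely_monotone_mult cmK completely_monotone_exp_minus_1 \<eta>
        completely_monotone_cmult completely_monotone_const) auto
  also have "(\<lambda>n. (\<integral>y. exp (- (real n * y)) \<partial>K) * (exp (\<eta> n) - 1)
      + exp (- \<Lambda>) * \<delta> * (exp (\<eta> n) - 1) + exp (- \<Lambda>) * \<delta>)
    = (\<lambda>n. (\<integral>y. exp (- (real n * y)) \<partial>N) - (\<integral>y. exp (- (real n * y)) \<partial>K))"
    unfolding N lapK by (simp add: fun_eq_iff exp_diff exp_minus field_simps)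
  finally have "emeasure K A \<le> emeasure N A"
    using assms finK K0 by (intro Laplace_comparison) (simp_all add: K_def)
  also have "emeasure K A = (\<integral>\<^sup>+ y. ennreal (?f y) * indicator ({0<..} \<inter> A) y \<partial>lborel)"
    unfolding K_def by (subst emeasure_density) (auto intro!: nn_integral_cong split: split_indicator)
  finally show ?thesis .
qed

text \<open>
  The constant \<open>\<Lambda>\<close> enters through the jump part of the exponent only, so the same bound serves all
  starting points \<open>x\<close>.
\<close>

lemma transition_density_ge_cir_density:
  fixes M :: "'a measure" and a \<sigma> \<theta> t x :: real and X :: "'a \<Rightarrow> real" and p :: "real \<Rightarrow> real"
  assumes pos: "0 < a" "0 < \<sigma>" "0 \<le> \<theta>" "0 < t" "0 \<le> x"
    and "prob_space M"
    and \<eta>: "completely_monotone \<eta>"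
    and jump: "\<And>n. (LINT s:{0..t}|lborel. LINT \<xi>:{0<..}|\<nu>. exp (of_real \<xi> * jcir_psi a \<sigma> s (- of_nat n)) - 1)
        = complex_of_real (\<eta> n - \<Lambda>)"
    and law: "\<And>u::complex. Re u \<le> 0 \<Longrightarrow> (LINT \<omega>|M. exp (u * of_real (X \<omega>))) = jcir_transform a \<sigma> \<theta> \<nu> t x u"
    and X: "distributed M (restrict_space lborel {0..}) X (\<lambda>y. ennreal (p y))"
  shows "AE y in restrict_space lborel {0..}. ennreal (exp (- \<Lambda>) * cir_density a \<sigma> \<theta> t x y) \<le> ennreal (p y)"
proof -
  interpret prob_space M by fact
  let ?R = "restrict_space lborel {0 :: real..}"
  let ?N = "distr M borel X"
  have XR: "X \<in> measurable M ?R" using distributed_measurable[OF X] .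
  have [measurable]: "X \<in> borel_measurable M"
    using measurable_restrict_space2_iff[THEN iffD1, OF XR] by simp
  have finN: "finite_measure ?N"
    by (rule finite_measure_distr) measurable
  have X0: "0 \<le> X \<omega>" if "\<omega> \<in> space M" for \<omega>
    using measurable_space[OF XR that] by (simp add: space_restrict_space)
  have b: "0 < cir_scale a \<sigma> t" using pos cir_scale_pos by simp
  have laplace: "(\<integral>y. exp (- (real n * y)) \<partial>?N) =
      (1 + real n * cir_scale a \<sigma> t) powr (- 2 * a * \<theta> / \<sigma>\<^sup>2) * exp (- (x * laplace_exponent a \<sigma> n t)) * exp (\<eta> n - \<Lambda>)" for n
  proof -
    have "complex_of_real (\<integral>\<omega>. exp (- (real n * X \<omega>)) \<partial>M) = (LINT \<omega>|M. exp (- of_nat n * of_real (X \<omega>)))"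
      by (subst integral_complex_of_real[symmetric]) (simp add: exp_of_real[symmetric])
    also have "\<dots> = jcir_transform a \<sigma> \<theta> \<nu> t x (- of_nat n)"
      by (rule law) simp
    also note jcir_transform_neg_nat[OF b jump]
    finally show ?thesis
      by (simp only: of_real_eq_iff) (simp add: integral_distr)
  qed
  have AX: "(\<integral>\<^sup>+ y. ennreal (p y) * indicator A y \<partial>?R) = emeasure ?N A" if A: "A \<in> sets ?R" for A
  proof -
    have "A \<in> sets borel" using A by (auto simp: sets_restrict_space)
    then show ?thesis
      using distributed_emeasure[OF X A] by (simp add: emeasure_distr)
  qed
  have le: "(\<integral>\<^sup>+ y. ennreal (exp (- \<Lambda>) * cir_density a \<sigma> \<theta> t x y) * indicator {0<..} y * indicator A y \<partial>?R)
      \<le> (\<integral>\<^sup>+ y. ennreal (p y) * indicator A y \<partial>?R)" if A: "A \<in> sets ?R" for A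
  proof -
    have A': "A \<in> sets borel" using A by (auto simp: sets_restrict_space)
    have "(\<integral>\<^sup>+ y. ennreal (exp (- \<Lambda>) * cir_density a \<sigma> \<theta> t x y) * indicator {0<..} y * indicator A y \<partial>?R)
      = (\<integral>\<^sup>+ y. ennreal (exp (- \<Lambda>) * cir_density a \<sigma> \<theta> t x y) * indicator ({0<..} \<inter> A) y \<partial>lborel)"
      by (subst nn_integral_restrict_space) (auto intro!: nn_integral_cong split: split_indicator)
    also have "\<dots> \<le> emeasure ?N A"
      using X0 by (intro cir_density_le_jcir_law[OF pos \<eta> finN _ _ laplace A']) (auto simp: AE_distr_iff)
    finally show ?thesis unfolding AX[OF A] .
  qed
  have "AE y in ?R. ennreal (exp (- \<Lambda>) * cir_density a \<sigma> \<theta> t x y) * indicator {0<..} y \<le> ennreal (p y)"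
  proof (rule AE_le_of_nn_integral_le[OF _ _ _ le])
    show "(\<lambda>y. ennreal (exp (- \<Lambda>) * cir_density a \<sigma> \<theta> t x y) * indicator {0<..} y) \<in> borel_measurable ?R"
      by (intro measurable_restrict_space1) measurable
    show "(\<lambda>y. ennreal (p y)) \<in> borel_measurable ?R"
      using X by (rule distributed_borel_measurable)
    have top: "space ?R \<in> sets ?R" by (rule sets.top)
    have "(\<integral>\<^sup>+ y. ennreal (exp (- \<Lambda>) * cir_density a \<sigma> \<theta> t x y) * indicator {0<..} y \<partial>?R) =
      (\<integral>\<^sup>+ y. ennreal (exp (- \<Lambda>) * cir_density a \<sigma> \<theta> t x y) * indicator {0<..} y * indicator (space ?R) y \<partial>?R)"
      by (intro nn_integral_cong) simp
    also have "\<dots> \<le> emeasure ?N (space ?R)"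
      using le[OF top] unfolding AX[OF top] .
    also have "\<dots> < \<infinity>"
      using finite_measure.emeasure_finite[OF finN] by (simp add: less_top[symmetric])
    finally show "(\<integral>\<^sup>+ y. ennreal (exp (- \<Lambda>) * cir_density a \<sigma> \<theta> t x y) * indicator {0<..} y \<partial>?R) < \<infinity>" .
  qed
  \<comment> \<open>At the endpoint the CIR density may follow a convention instead of the Bessel series; it is a null set.\<close>
  moreover have "AE y in ?R. y \<noteq> 0"
    using AE_lborel_singleton[of "0 :: real"] by (subst AE_restrict_space_iff) auto
  ultimately show ?thesis
    using AE_space by eventually_elim (auto simp: space_restrict_space split: split_indicator)
qed

theorem proposition3p3:
  fixes M :: "'a measure" and F :: "real \<Rightarrow> 'a measure"
    and a \<sigma> \<theta> :: real and \<nu> :: "real measure"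
    and W J :: "real \<Rightarrow> 'a \<Rightarrow> real"
    and X :: "real \<Rightarrow> real \<Rightarrow> 'a \<Rightarrow> real"
    and p :: "real \<Rightarrow> real \<Rightarrow> real \<Rightarrow> real"
  assumes "a > 0" and "\<sigma> > 0" and "\<theta> \<ge> 0"
    and "positive_levy_measure \<nu>"
    and "filtered_prob_space M F"
    and "brownian_motion M F W"
    and "pure_jump_levy_process M F \<nu> J"
    and "independent_processes M W J"
    and "\<forall>x\<ge>0. jcir_process M F a \<sigma> \<theta> W J x (X x)"
    and law: "\<forall>x\<ge>0. \<forall>t\<ge>0. \<forall>u::complex. Re u \<le> 0 \<longrightarrow>
          (LINT \<omega>|M. exp (u * of_real (X x t \<omega>))) = jcir_transform a \<sigma> \<theta> \<nu> t x u"
    and "transition_density M X p"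
    and log_moment: "(\<integral>\<^sup>+ \<xi>\<in>{0<..<1}. ennreal (\<xi> * ln (1 / \<xi>)) \<partial>\<nu>) < \<infinity>"
  shows "\<exists>C. (\<forall>t>0. C t > 0) \<and>
      (\<forall>t>0. \<forall>x\<ge>0. AE y in lborel. y \<ge> 0 \<longrightarrow> p t x y \<ge> C t * cir_density a \<sigma> \<theta> t x y) \<and>
      (\<exists>p'. transition_density M X p' \<and>
         (\<forall>t>0. \<forall>x\<ge>0. \<forall>y\<ge>0. p' t x y \<ge> C t * cir_density a \<sigma> \<theta> t x y))"
proof -
  let ?R = "restrict_space lborel {0 :: real..}"
  have M: "prob_space M"
    using \<open>filtered_prob_space M F\<close> by (simp add: filtered_prob_space_def)
  have p0: "0 \<le> p t x y" if "0 < t" "0 \<le> x" "0 \<le> y" for t x y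
    using \<open>transition_density M X p\<close> that by (simp add: transition_density_def)
  have dist: "distributed M ?R (X x t) (\<lambda>y. ennreal (p t x y))" if "0 < t" "0 \<le> x" for t x
    using \<open>transition_density M X p\<close> that by (simp add: transition_density_def)
  have "\<exists>\<Lambda>. \<forall>x\<ge>0. AE y in ?R. ennreal (exp (- \<Lambda>) * cir_density a \<sigma> \<theta> t x y) \<le> ennreal (p t x y)"
    if t: "0 < t" for t
  proof -
    obtain \<Lambda> \<eta> where \<eta>: "completely_monotone \<eta>"
      and jump: "\<And>n. (LINT s:{0..t}|lborel. LINT \<xi>:{0<..}|\<nu>. exp (of_real \<xi> * jcir_psi a \<sigma> s (- of_nat n)) - 1)
        = complex_of_real (\<eta> n - \<Lambda>)"
      using jump_exponent_completely_monotone[OF assms(1,2) t assms(4) log_moment] by blast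
    show ?thesis
      using law t
      by (intro exI[of _ \<Lambda>] allI impI transition_density_ge_cir_density[OF assms(1-3) t _ M \<eta> jump _ dist[OF t]]) auto
  qed
  then obtain \<Lambda> where \<Lambda>: "\<And>t x. 0 < t \<Longrightarrow> 0 \<le> x \<Longrightarrow>
      AE y in ?R. ennreal (exp (- \<Lambda> t) * cir_density a \<sigma> \<theta> t x y) \<le> ennreal (p t x y)"
    by metis
  let ?C = "\<lambda>t. exp (- \<Lambda> t)"
  let ?p' = "\<lambda>t x y. max (p t x y) (?C t * cir_density a \<sigma> \<theta> t x y)"
  show ?thesis
  proof (intro exI[of _ ?C] conjI)
    show "\<forall>t>0. \<forall>x\<ge>0. AE y in lborel. y \<ge> 0 \<longrightarrow> p t x y \<ge> ?C t * cir_density a \<sigma> \<theta> t x y"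
    proof (intro allI impI)
      fix t x :: real assume tx: "0 < t" "0 \<le> x"
      have "AE y in lborel. y \<in> {0..} \<longrightarrow> ennreal (?C t * cir_density a \<sigma> \<theta> t x y) \<le> ennreal (p t x y)"
        using \<Lambda>[OF tx] by (subst (asm) AE_restrict_space_iff) auto
      then show "AE y in lborel. y \<ge> 0 \<longrightarrow> p t x y \<ge> ?C t * cir_density a \<sigma> \<theta> t x y"
        by eventually_elim (use p0[OF tx] in \<open>auto simp: ennreal_le_iff\<close>)
    qed
    have "distributed M ?R (X x t) (\<lambda>y. ennreal (?p' t x y))" if "0 < t" "0 \<le> x" for t x
    proof (rule distributed_max[OF dist[OF that] _ \<Lambda>[OF that]])
      show "(\<lambda>y. ?C t * cir_density a \<sigma> \<theta> t x y) \<in> borel_measurable ?R"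
        by (intro measurable_restrict_space1) measurable
    qed
    then have "transition_density M X ?p'"
      using p0 by (auto simp: transition_density_def le_max_iff_disj)
    then show "\<exists>p'. transition_density M X p' \<and>
         (\<forall>t>0. \<forall>x\<ge>0. \<forall>y\<ge>0. p' t x y \<ge> ?C t * cir_density a \<sigma> \<theta> t x y)"
      by (intro exI[of _ ?p']) auto
  qed simp
qed

end
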